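(* Let $G$ be an infinite, connected, bipartite graph with maximum degree $d$ and Cheeger constant $h$, and let $M\ge 1$ be an integer. Assume $h\ge 4M\log\big(3d^4(4M+1)\big)$. Let $a\le b$ be integers with $b-a\le 2M$. (a) For every exhaustion $(G_n)$ of $G$, the measures $\nu^{a,b}_{G_n,M}$ converge as $n\to\infty$ to a Gibbs measure $\nu^{a,b}_{G,M}$. (b) The measures $\nu^{a,b}_{G,M}$ are distinct for different pairs $(a,b)$.
   Context: The Cheeger constant is $h(G)=\inf\{|\partial S|/|S| : S\subset V,\ 0<|S|<\infty\}$, where $\partial S$ is the set of vertices not in $S$ having at least one neighbour in $S$. The two partite classes of $G$ are colored white and black. An $M$-Lipschitz function on a set of vertices is a function $f$ to $\mathbb{Z}$ with $|f(u)-f(v)|\le M$ for adjacent $u,v$ in that set. For a finite vertex set $U$ and integers $a\le b$, $\nu^{a,b}_{U,M}$ is the uniform probability measure on the set of $M$-Lipschitz functions on $U\cup\partial U$ whose value at each white vertex of $\partial U$ lies in $\{a,\dots,b\}$ and whose value at each black vertex of $\partial U$ lies in $\{b-M,\dots,a+M\}$. An exhaustion of $G$ is a sequence of finite vertex sets $G_1\subset G_2\subset\cdots$ with $\bigcup_n G_n=V(G)$. Convergence is local weak convergence: for each finite set of vertices, the joint law of the values there converges. *)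

theory Defs
  imports "HOL-Probability.Probability"
begin

text \<open>Graphs: vertex type 'v, adjacency relation E (symmetric, irreflexive).\<close>

definition simple_graph :: "('v \<Rightarrow> 'v \<Rightarrow> bool) \<Rightarrow> bool" where
  "simple_graph E \<longleftrightarrow> (\<forall>u v. E u v \<longrightarrow> E v u) \<and> (\<forall>v. \<not> E v v)"

definition connected_graph :: "('v \<Rightarrow> 'v \<Rightarrow> bool) \<Rightarrow> bool" where
  "connected_graph E \<longleftrightarrow> (\<forall>u v. (u, v) \<in> {(x, y). E x y}\<^sup>*)"

text \<open>white is a proper 2-colouring (white / black partite classes).\<close>
definition proper_bicolouring :: "('v \<Rightarrow> 'v \<Rightarrow> bool) \<Rightarrow> ('v \<Rightarrow> bool) \<Rightarrow> bool" where
  "proper_bicolouring E white \<longleftrightarrow> (\<forall>u v. E u v \<longrightarrow> white u \<noteq> white v)"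

definition nbrs :: "('v \<Rightarrow> 'v \<Rightarrow> bool) \<Rightarrow> 'v \<Rightarrow> 'v set" where
  "nbrs E v = {u. E v u}"

text \<open>Maximum degree equals d.\<close>
definition max_degree :: "('v \<Rightarrow> 'v \<Rightarrow> bool) \<Rightarrow> nat \<Rightarrow> bool" where
  "max_degree E d \<longleftrightarrow> (\<forall>v. finite (nbrs E v) \<and> card (nbrs E v) \<le> d) \<and> (\<exists>v. card (nbrs E v) = d)"

text \<open>Outer vertex boundary.\<close>
definition bdry :: "('v \<Rightarrow> 'v \<Rightarrow> bool) \<Rightarrow> 'v set \<Rightarrow> 'v set" where
  "bdry E S = {v. v \<notin> S \<and> (\<exists>u\<in>S. E u v)}"

definition cheeger :: "('v \<Rightarrow> 'v \<Rightarrow> bool) \<Rightarrow> real" where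
  "cheeger E = Inf {real (card (bdry E S)) / real (card S) | S. finite S \<and> S \<noteq> {}}"

text \<open>M-Lipschitz on a set of vertices.\<close>
definition lip_on :: "('v \<Rightarrow> 'v \<Rightarrow> bool) \<Rightarrow> int \<Rightarrow> 'v set \<Rightarrow> ('v \<Rightarrow> int) \<Rightarrow> bool" where
  "lip_on E M S f \<longleftrightarrow> (\<forall>u\<in>S. \<forall>v\<in>S. E u v \<longrightarrow> \<bar>f u - f v\<bar> \<le> M)"

text \<open>Configurations underlying nu^{a,b}_{U,M}: functions on U \<union> \<partial>U
  (extended by 0 elsewhere).\<close>
definition cfgs :: "('v \<Rightarrow> 'v \<Rightarrow> bool) \<Rightarrow> ('v \<Rightarrow> bool) \<Rightarrow> int \<Rightarrow> int \<Rightarrow> int \<Rightarrow> 'v set \<Rightarrow> ('v \<Rightarrow> int) set" where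
  "cfgs E white M a b U =
     {f. (\<forall>x. x \<notin> U \<union> bdry E U \<longrightarrow> f x = 0)
       \<and> lip_on E M (U \<union> bdry E U) f
       \<and> (\<forall>v\<in>bdry E U. white v \<longrightarrow> a \<le> f v \<and> f v \<le> b)
       \<and> (\<forall>v\<in>bdry E U. \<not> white v \<longrightarrow> b - M \<le> f v \<and> f v \<le> a + M)}"

definition nu :: "('v \<Rightarrow> 'v \<Rightarrow> bool) \<Rightarrow> ('v \<Rightarrow> bool) \<Rightarrow> int \<Rightarrow> int \<Rightarrow> int \<Rightarrow> 'v set \<Rightarrow> ('v \<Rightarrow> int) pmf" where
  "nu E white M a b U = pmf_of_set (cfgs E white M a b U)"

text \<open>Product space of integer-valued configurations on all vertices.\<close>
definition config_space :: "('v \<Rightarrow> int) measure" where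
  "config_space = PiM UNIV (\<lambda>_. count_space UNIV)"

text \<open>Probability that the configuration agrees with xi on the finite set A.\<close>
definition cyl :: "('v \<Rightarrow> int) measure \<Rightarrow> 'v set \<Rightarrow> ('v \<Rightarrow> int) \<Rightarrow> real" where
  "cyl \<mu> A \<xi> = measure \<mu> {\<sigma> \<in> space \<mu>. \<forall>x\<in>A. \<sigma> x = \<xi> x}"

text \<open>Lipschitz extensions into U of the outside configuration xi (only edges touching U).\<close>
definition lip_touch :: "('v \<Rightarrow> 'v \<Rightarrow> bool) \<Rightarrow> int \<Rightarrow> 'v set \<Rightarrow> ('v \<Rightarrow> int) \<Rightarrow> bool" where
  "lip_touch E M U f \<longleftrightarrow> (\<forall>u\<in>U. \<forall>v. E u v \<longrightarrow> \<bar>f u - f v\<bar> \<le> M)"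

definition extensions :: "('v \<Rightarrow> 'v \<Rightarrow> bool) \<Rightarrow> int \<Rightarrow> 'v set \<Rightarrow> ('v \<Rightarrow> int) \<Rightarrow> ('v \<Rightarrow> int) set" where
  "extensions E M U \<xi> = {g. (\<forall>x. x \<notin> U \<longrightarrow> g x = 0) \<and> lip_touch E M U (\<lambda>x. if x \<in> U then g x else \<xi> x)}"

text \<open>Gibbs measure for the uniform M-Lipschitz specification (DLR equations,
  written on cylinder events, which is equivalent since the spin space is discrete):
  conditionally on the outside of a finite U, the configuration on U is uniform
  among the M-Lipschitz extensions.\<close>
definition gibbs :: "('v \<Rightarrow> 'v \<Rightarrow> bool) \<Rightarrow> int \<Rightarrow> ('v \<Rightarrow> int) measure \<Rightarrow> bool" where
  "gibbs E M \<mu> \<longleftrightarrow> prob_space \<mu> \<and> sets \<mu> = sets config_space \<and>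
     (\<forall>U \<Lambda> \<xi>. finite U \<and> finite \<Lambda> \<and> U \<union> bdry E U \<subseteq> \<Lambda> \<longrightarrow>
        cyl \<mu> \<Lambda> \<xi> = cyl \<mu> (\<Lambda> - U) \<xi> *
          (if lip_touch E M U \<xi> then 1 / real (card (extensions E M U \<xi>)) else 0))"

definition exhaustion :: "(nat \<Rightarrow> 'v set) \<Rightarrow> bool" where
  "exhaustion Gn \<longleftrightarrow> (\<forall>n. finite (Gn n) \<and> Gn n \<subseteq> Gn (Suc n)) \<and> (\<Union>n. Gn n) = UNIV"

text \<open>Local weak convergence: for each finite A, the joint law of the values on A
  converges (pointwise convergence of the law on the countable space Z^A).\<close>
definition local_conv :: "(nat \<Rightarrow> ('v \<Rightarrow> int) pmf) \<Rightarrow> ('v \<Rightarrow> int) measure \<Rightarrow> bool" where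
  "local_conv P \<mu> \<longleftrightarrow> (\<forall>A \<xi>. finite A \<longrightarrow>
     (\<lambda>n. measure_pmf.prob (P n) {f. \<forall>x\<in>A. f x = \<xi> x}) \<longlonglongrightarrow> cyl \<mu> A \<xi>)"

end

theory Submission
  imports Defs
begin

text \<open>
Call a value good at a white vertex if it lies in \<open>{a..b}\<close> and at a black vertex if it lies in
\<open>{b - M..a + M}\<close>. Good values at adjacent vertices are always compatible, so a set \<open>B\<close> of bad
vertices surrounded by good ones can be overwritten by good values; this also frees the vertices of
the boundary of \<open>B\<close>, each of which had lost one of its at most \<open>2 M + 1\<close> values. Since that boundary has
at least \<open>h |B|\<close> vertices, such a \<open>B\<close> has probability at most \<open>\<rho> ^ |B|\<close> with
\<open>\<rho> = (4 M + 1) (2 M / (2 M + 1)) ^ h\<close>, and the hypothesis on \<open>h\<close> makes \<open>3 d^4 \<rho>\<close> small.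

For two independent samples on \<open>U\<close> and \<open>W\<close>, consider the cluster of a finite set \<open>A\<close>
formed by vertices that are bad in either sample, with steps of length at most two. There are at most
\<open>d^(4n)\<close> shapes and \<open>3^n\<close> types for a cluster with \<open>n\<close> new vertices, so it is finite with exponential
tails. If its closure stays inside \<open>U \<inter> W\<close>, exchanging the two samples on it is an involution; hence
the laws on \<open>A\<close> are close in total variation, which gives the limit. The limits are distinct,
since a white vertex rarely takes a value outside \<open>{a..b}\<close>, but takes each value inside with
probability bounded below.
\<close>

section \<open>Limits of total-variation Cauchy laws\<close>

text \<open>Setwise limits are finitely additive for free. Uniformity over \<open>S\<close>
  transfers continuity at the empty set from a single \<open>p N\<close> to the limit, which gives
  countable additivity.\<close>

lemma tv_Cauchy_pmf_limit:
  fixes p :: "nat \<Rightarrow> 'a pmf"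
  assumes cauchy: "\<And>e. e > 0 \<Longrightarrow> \<exists>N. \<forall>m\<ge>N. \<forall>n\<ge>N. \<forall>S.
     \<bar>measure_pmf.prob (p m) S - measure_pmf.prob (p n) S\<bar> \<le> e"
  shows "\<exists>q. \<forall>S. (\<lambda>n. measure_pmf.prob (p n) S) \<longlonglongrightarrow> measure_pmf.prob q S"
proof -
  define L where "L S = lim (\<lambda>n. measure_pmf.prob (p n) S)" for S
  have L: "(\<lambda>n. measure_pmf.prob (p n) S) \<longlonglongrightarrow> L S" for S
  proof -
    have "Cauchy (\<lambda>n. measure_pmf.prob (p n) S)"
      unfolding Cauchy_altdef2
    proof (intro allI impI)
      fix e :: real assume "e > 0"
      then obtain N where N: "\<forall>m\<ge>N. \<forall>n\<ge>N. \<forall>S. \<bar>measure_pmf.prob (p m) S - measure_pmf.prob (p n) S\<bar> \<le> e/2"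
        using cauchy[of "e/2"] by auto
      have "dist (measure_pmf.prob (p n) S) (measure_pmf.prob (p N) S) < e" if "n \<ge> N" for n
      proof -
        have "\<bar>measure_pmf.prob (p n) S - measure_pmf.prob (p N) S\<bar> \<le> e/2" using N that by blast
        then show ?thesis using \<open>e > 0\<close> by (simp add: dist_real_def)
      qed
      then show "\<exists>N. \<forall>n\<ge>N. dist (measure_pmf.prob (p n) S) (measure_pmf.prob (p N) S) < e" by blast
    qed
    then show ?thesis unfolding L_def using Cauchy_convergent_iff convergent_LIMSEQ_iff by blast
  qed
  have L0: "0 \<le> L S" for S
    by (rule LIMSEQ_le_const[OF L]) auto
  have Ladd: "L (A \<union> B) = L A + L B" if "A \<inter> B = {}" for A B
  proof (rule LIMSEQ_unique[OF L])
    have "measure_pmf.prob (p n) (A \<union> B) = measure_pmf.prob (p n) A + measure_pmf.prob (p n) B" for n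
      using that by (intro measure_pmf.finite_measure_Union) auto
    then show "(\<lambda>n. measure_pmf.prob (p n) (A \<union> B)) \<longlonglongrightarrow> L A + L B"
      by (simp add: tendsto_add L)
  qed
  have Lemp: "L {} = 0" by (rule LIMSEQ_unique[OF L]) simp
  have Luniv: "L UNIV = 1" by (rule LIMSEQ_unique[OF L]) simp
  have Lclose: "\<exists>N. \<forall>S. L S \<le> measure_pmf.prob (p N) S + e" if "e > 0" for e
  proof -
    obtain N where N: "\<forall>m\<ge>N. \<forall>n\<ge>N. \<forall>S. \<bar>measure_pmf.prob (p m) S - measure_pmf.prob (p n) S\<bar> \<le> e"
      using cauchy[of e] \<open>e > 0\<close> by auto
    have "L S \<le> measure_pmf.prob (p N) S + e" for S
    proof (rule LIMSEQ_le_const2[OF L], intro exI allI impI)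
      fix n assume "n \<ge> N"
      then have "\<bar>measure_pmf.prob (p n) S - measure_pmf.prob (p N) S\<bar> \<le> e" using N by blast
      then show "measure_pmf.prob (p n) S \<le> measure_pmf.prob (p N) S + e" by linarith
    qed
    then show ?thesis by blast
  qed
  define \<mu> where "\<mu> = measure_of UNIV UNIV (\<lambda>S. ennreal (L S))"
  interpret R: sigma_algebra "UNIV :: 'a set" UNIV
    using sigma_algebra_Pow[of "UNIV :: 'a set"] by simp
  have ca: "countably_additive UNIV (\<lambda>S. ennreal (L S))"
  proof (rule R.empty_continuous_imp_countably_additive)
    show "positive UNIV (\<lambda>S. ennreal (L S))" by (simp add: positive_def Lemp)
    show "additive UNIV (\<lambda>S. ennreal (L S))" by (auto simp: additive_def Ladd L0 ennreal_plus)
    fix A :: "nat \<Rightarrow> 'a set"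
    assume A: "range A \<subseteq> UNIV" "decseq A" "(\<Inter>i. A i) = {}"
    have "(\<lambda>i. L (A i)) \<longlonglongrightarrow> 0"
    proof (rule LIMSEQ_I)
      fix r :: real assume r: "0 < r"
      then obtain N where N: "\<And>S. L S \<le> measure_pmf.prob (p N) S + r/2" using Lclose[of "r/2"] by auto
      have "(\<lambda>i. measure_pmf.prob (p N) (A i)) \<longlonglongrightarrow> measure_pmf.prob (p N) (\<Inter>i. A i)"
        using A by (intro measure_pmf.finite_Lim_measure_decseq) auto
      then have "(\<lambda>i. measure_pmf.prob (p N) (A i)) \<longlonglongrightarrow> 0" using A by simp
      then obtain n0 where n0: "\<And>n. n \<ge> n0 \<Longrightarrow> measure_pmf.prob (p N) (A n) < r/2"
        using LIMSEQ_D[of _ 0 "r/2"] r by fastforce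
      have "norm (L (A n) - 0) < r" if "n \<ge> n0" for n
        using n0[OF that] N[of "A n"] L0[of "A n"] by simp
      then show "\<exists>no. \<forall>n\<ge>no. norm (L (A n) - 0) < r" by blast
    qed
    then show "(\<lambda>i. ennreal (L (A i))) \<longlonglongrightarrow> 0"
      using tendsto_ennrealI by fastforce
  qed auto
  have em: "emeasure \<mu> S = ennreal (L S)" for S
    unfolding \<mu>_def using ca
    by (intro emeasure_measure_of_sigma) (auto simp: positive_def Lemp sigma_algebra_Pow[of UNIV, simplified])
  have sets: "sets \<mu> = UNIV" unfolding \<mu>_def
    using sigma_algebra.sets_measure_of_eq[OF sigma_algebra_Pow[of UNIV]] by simp
  have space: "space \<mu> = UNIV" unfolding \<mu>_def by (simp add: space_measure_of_conv)
  have pr: "prob_space \<mu>" by (rule prob_spaceI) (simp add: em space Luniv)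
  interpret \<mu>: prob_space \<mu> by (rule pr)
  have meas: "measure \<mu> S = L S" for S by (simp add: measure_def em L0)
  \<comment> \<open>A \<open>pmf\<close> requires that almost every point be an atom. The supports
    of all \<open>p n\<close> together form a countable set of full limit mass, and its points of
    mass zero form a null set.\<close>
  define C where "C = (\<Union>n. set_pmf (p n))"
  have C: "countable C" unfolding C_def by auto
  have "L (- C) = 0"
  proof (rule LIMSEQ_unique[OF L])
    have "measure_pmf.prob (p n) (- C) = 0" for n
      by (rule measure_pmf_zero_iff[THEN iffD2]) (auto simp: C_def)
    then show "(\<lambda>n. measure_pmf.prob (p n) (- C)) \<longlonglongrightarrow> 0" by simp
  qed
  then have n1: "- C \<in> null_sets \<mu>" by (intro null_setsI) (auto simp: em sets)
  have n2: "(\<Union>x\<in>{x\<in>C. L {x} = 0}. {x}) \<in> null_sets \<mu>"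
    using C by (intro null_sets_UN') (auto intro!: null_setsI simp: em sets)
  have ae: "AE x in \<mu>. measure \<mu> {x} \<noteq> 0"
    by (rule AE_I'[OF null_sets.Un[OF n1 n2]]) (auto simp: meas space)
  define q where "q = Abs_pmf \<mu>"
  have "measure_pmf q = \<mu>" unfolding q_def
    by (rule Abs_pmf_inverse) (auto simp: sets ae pr)
  then show ?thesis using L meas by metis
qed

text \<open>The real line is Polish, so integer values are embedded in the reals, the projective
  limit is taken there, and the floor function carries it back to integer configurations.\<close>

lemma int_Kolmogorov_extension:
  fixes q :: "'v set \<Rightarrow> ('v \<Rightarrow> int) pmf"
  assumes proj: "\<And>J H. finite H \<Longrightarrow> J \<subseteq> H \<Longrightarrow> map_pmf (\<lambda>f. restrict f J) (q H) = q J"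
  shows "\<exists>\<mu>. prob_space \<mu> \<and> sets \<mu> = sets config_space \<and>
    (\<forall>A \<xi>. finite A \<longrightarrow> cyl \<mu> A \<xi> = measure_pmf.prob (q A) {f. \<forall>x\<in>A. f x = \<xi> x})"
proof -
  define R where "R J f = (\<lambda>x\<in>J. real_of_int (f x))" for J and f :: "'v \<Rightarrow> int"
  define P where "P J = distr (measure_pmf (q J)) (\<Pi>\<^sub>M i\<in>J. (borel :: real measure)) (R J)" for J
  have Rm[measurable]: "R J \<in> measure_pmf (q H) \<rightarrow>\<^sub>M (\<Pi>\<^sub>M i\<in>J. (borel :: real measure))" for J H
    by (auto simp: R_def space_PiM)
  interpret pp: polish_projective UNIV P
  proof (rule polish_projective.intro, rule projective_family.intro)
    fix J H :: "'v set" assume JH: "J \<subseteq> H" "finite H"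
    have "P J = distr (distr (measure_pmf (q H)) (count_space UNIV) (\<lambda>f. restrict f J)) (\<Pi>\<^sub>M i\<in>J. borel) (R J)"
      unfolding P_def proj[OF JH(2,1), symmetric] map_pmf_rep_eq ..
    also have "\<dots> = distr (measure_pmf (q H)) (\<Pi>\<^sub>M i\<in>J. borel) (R J \<circ> (\<lambda>f. restrict f J))"
      by (rule distr_distr) (auto simp: R_def space_PiM)
    also have "R J \<circ> (\<lambda>f. restrict f J) = (\<lambda>f. restrict f J) \<circ> R H"
      using JH by (auto simp: R_def fun_eq_iff)
    also have "distr (measure_pmf (q H)) (\<Pi>\<^sub>M i\<in>J. borel) \<dots> = distr (P H) (\<Pi>\<^sub>M i\<in>J. borel) (\<lambda>f. restrict f J)"
      unfolding P_def using JH(1) by (intro distr_distr[OF _ Rm, symmetric] measurable_restrict_subset) auto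
    finally show "P J = distr (P H) (\<Pi>\<^sub>M i\<in>J. borel) (\<lambda>f. restrict f J)" .
  next
    fix J :: "'v set"
    show "prob_space (P J)" unfolding P_def by (rule measure_pmf.prob_space_distr[OF Rm])
  qed
  define \<mu> where "\<mu> = distr pp.lim config_space (\<lambda>\<omega> x. \<lfloor>\<omega> x\<rfloor>)"
  have lim_sets: "sets pp.lim = sets (\<Pi>\<^sub>M i\<in>UNIV. (borel :: real measure))" by simp
  have m: "(\<lambda>\<omega> x. \<lfloor>\<omega> x\<rfloor>) \<in> pp.lim \<rightarrow>\<^sub>M config_space"
    unfolding config_space_def measurable_cong_sets[OF lim_sets refl]
    by (intro measurable_PiM_single') (auto simp: space_PiM)
  have "prob_space \<mu>" unfolding \<mu>_def by (rule pp.P.prob_space_distr[OF m])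
  moreover have "sets \<mu> = sets config_space" unfolding \<mu>_def by simp
  moreover have "cyl \<mu> A \<xi> = measure_pmf.prob (q A) {f. \<forall>x\<in>A. f x = \<xi> x}" if A: "finite A" for A \<xi>
  proof -
    \<comment> \<open>Prescribed integer values become half-open unit intervals, so the cylinder
      event pulls back to a Borel rectangle over \<open>A\<close>, whose mass can be read off from
      \<open>P A\<close>.\<close>
    let ?X = "PiE A (\<lambda>x. {t. \<lfloor>t\<rfloor> = \<xi> x}) :: ('v \<Rightarrow> real) set"
    have floor_meas: "{t :: real. \<lfloor>t\<rfloor> = k} \<in> sets borel" for k
    proof -
      have "{t :: real. \<lfloor>t\<rfloor> = k} = {real_of_int k..<real_of_int k + 1}" by (auto simp: floor_eq_iff)
      then show ?thesis by simp
    qed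
    have X: "?X \<in> sets (\<Pi>\<^sub>M i\<in>A. borel)" using A floor_meas by (intro sets_PiM_I_finite) auto
    have cs: "{\<sigma> \<in> space config_space. \<forall>x\<in>A. \<sigma> x = \<xi> x} = prod_emb UNIV (\<lambda>_. count_space UNIV) A (PiE A (\<lambda>x. {\<xi> x}))"
      by (auto simp: config_space_def space_PiM prod_emb_def PiE_def Pi_def extensional_def)
    have "{\<sigma> \<in> space config_space. \<forall>x\<in>A. \<sigma> x = \<xi> x} \<in> sets config_space"
      unfolding cs unfolding config_space_def using A by (intro sets_PiM_I) auto
    then have "cyl \<mu> A \<xi> = measure pp.lim ((\<lambda>\<omega> x. \<lfloor>\<omega> x\<rfloor>) -` {\<sigma> \<in> space config_space. \<forall>x\<in>A. \<sigma> x = \<xi> x} \<inter> space pp.lim)"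
      unfolding cyl_def \<mu>_def by (simp add: measure_distr[OF m])
    also have "(\<lambda>\<omega> x. \<lfloor>\<omega> x\<rfloor>) -` {\<sigma> \<in> space config_space. \<forall>x\<in>A. \<sigma> x = \<xi> x} \<inter> space pp.lim
        = prod_emb UNIV (\<lambda>_. borel) A ?X"
      by (auto simp: config_space_def space_PiM prod_emb_def PiE_def Pi_def extensional_def)
    also have "measure pp.lim \<dots> = measure (P A) ?X"
      by (rule pp.measure_lim_emb) (use A X in auto)
    also have "\<dots> = measure_pmf.prob (q A) (R A -` ?X)"
      unfolding P_def using X by (simp add: measure_distr[OF Rm])
    also have "R A -` ?X = {f. \<forall>x\<in>A. f x = \<xi> x}" by (auto simp: R_def Pi_iff)
    finally show ?thesis .
  qed
  ultimately show ?thesis by blast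
qed

text \<open>Each finite \<open>A\<close> has a limit law \<open>q A\<close>. Restricting from
  \<open>H\<close> to \<open>J\<close> commutes with the limit, so these laws are consistent and
  Kolmogorov extension applies.\<close>

lemma local_limit_exists:
  fixes P :: "nat \<Rightarrow> ('v \<Rightarrow> int) pmf"
  assumes cauchy: "\<And>A e. finite A \<Longrightarrow> e > 0 \<Longrightarrow> \<exists>N. \<forall>m\<ge>N. \<forall>n\<ge>N. \<forall>S.
     \<bar>measure_pmf.prob (P m) {f. restrict f A \<in> S} - measure_pmf.prob (P n) {f. restrict f A \<in> S}\<bar> \<le> e"
  shows "\<exists>\<mu>. prob_space \<mu> \<and> sets \<mu> = sets config_space \<and> local_conv P \<mu>"
proof -
  have "\<exists>q. \<forall>S. (\<lambda>n. measure_pmf.prob (P n) {f. restrict f A \<in> S}) \<longlonglongrightarrow> measure_pmf.prob q S"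
    if "finite A" for A
  proof -
    have eq: "measure_pmf.prob (map_pmf (\<lambda>f. restrict f A) (P n)) S = measure_pmf.prob (P n) {f. restrict f A \<in> S}" for n S
      by (simp add: vimage_def)
    show ?thesis using tv_Cauchy_pmf_limit[of "\<lambda>n. map_pmf (\<lambda>f. restrict f A) (P n)"] cauchy[OF that]
      unfolding eq by blast
  qed
  then obtain q where q: "\<And>A S. finite A \<Longrightarrow>
      (\<lambda>n. measure_pmf.prob (P n) {f. restrict f A \<in> S}) \<longlonglongrightarrow> measure_pmf.prob (q A) S" by metis
  have "map_pmf (\<lambda>f. restrict f J) (q H) = q J" if "finite H" "J \<subseteq> H" for J H
  proof (rule pmf_eqI)
    fix i
    have fJ: "finite J" using that finite_subset by blast
    have *: "{f :: 'v \<Rightarrow> int. restrict f H \<in> (\<lambda>f. restrict f J) -` {i}} = {f. restrict f J \<in> {i}}"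
      using that(2) by (auto simp: Int_absorb1)
    have "(\<lambda>n. measure_pmf.prob (P n) {f. restrict f J \<in> {i}}) \<longlonglongrightarrow> measure_pmf.prob (q H) ((\<lambda>f. restrict f J) -` {i})"
      using q[OF that(1), of "(\<lambda>f. restrict f J) -` {i}"] unfolding * .
    from LIMSEQ_unique[OF this q[OF fJ]]
    show "pmf (map_pmf (\<lambda>f. restrict f J) (q H)) i = pmf (q J) i"
      by (simp add: pmf_map measure_pmf_single)
  qed
  from int_Kolmogorov_extension[OF this] obtain \<mu> where \<mu>: "prob_space \<mu>" "sets \<mu> = sets config_space"
    "\<And>A \<xi>. finite A \<Longrightarrow> cyl \<mu> A \<xi> = measure_pmf.prob (q A) {f. \<forall>x\<in>A. f x = \<xi> x}" by blast
  have "(\<lambda>n. measure_pmf.prob (P n) {f. \<forall>x\<in>A. f x = \<xi> x}) \<longlonglongrightarrow> cyl \<mu> A \<xi>" if "finite A" for A \<xi>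
  proof -
    have "{f. restrict f A \<in> {f. \<forall>x\<in>A. f x = \<xi> x}} = {f. \<forall>x\<in>A. f x = \<xi> x}" by auto
    then show ?thesis using q[OF that, of "{f. \<forall>x\<in>A. f x = \<xi> x}"] \<mu>(3)[OF that] by simp
  qed
  then show ?thesis using \<mu>(1,2) unfolding local_conv_def by blast
qed

section \<open>Expanders and the numerical hypothesis\<close>

text \<open>With \<open>X = 3 * D ^ 4 * (4 * M + 1)\<close>, the inequality
  \<open>ln t \<le> t - 1\<close> bounds the \<open>powr\<close> factor by
  \<open>X powr (- 4 / 3)\<close>. One power of \<open>X\<close> cancels the prefactor, and the
  remaining third of a power absorbs \<open>100 * (M + 1)\<close>.\<close>

lemma weight_bound:
  fixes M D h :: real
  assumes M: "1 \<le> M" and D: "1 \<le> D" "h \<le> D"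
    and h: "4 * M * ln (3 * D ^ 4 * (4 * M + 1)) \<le> h"
  shows "3 * D ^ 4 * ((4 * M + 1) * (2 * M / (2 * M + 1)) powr h) \<le> 1 / (100 * (M + 1))"
proof -
  define X where "X = 3 * D ^ 4 * (4 * M + 1)"
  have lnX: "real k \<le> ln X" if "3 ^ k \<le> X" for k
  proof -
    have "exp (real k) = exp 1 ^ k" by (simp add: exp_of_nat_mult[symmetric])
    also have "\<dots> \<le> 3 ^ k" by (intro power_mono exp_le) auto
    finally have "exp (real k) \<le> X" using that by simp
    moreover have "0 < X" using that by (smt (verit) zero_less_power)
    ultimately show ?thesis by (simp add: ln_ge_iff)
  qed
  have X_mono: "3 * c ^ 4 * 5 \<le> X" if "0 \<le> c" "c \<le> D" for c
    unfolding X_def using that M D by (intro mult_mono power_mono) auto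
  have step: "4 * M * real k \<le> D" if "3 ^ k \<le> X" for k
  proof -
    have "4 * M * real k \<le> 4 * M * ln X" using lnX[OF that] M by (intro mult_left_mono) auto
    then show ?thesis using h D unfolding X_def by linarith
  qed
  \<comment> \<open>Bootstrap: since \<open>h \<le> D\<close>, a lower bound on \<open>X\<close>
    forces one on \<open>D\<close>, which in turn improves the one on \<open>X\<close>. Two rounds
    lead from \<open>1 \<le> D\<close> through \<open>8 \<le> D\<close> to
    \<open>40 * M \<le> D\<close>.\<close>
  have "(3::real) ^ 2 \<le> X" using X_mono[of 1] D by simp
  from step[OF this] have "8 \<le> D" using M by simp
  then have "(3::real) ^ 10 \<le> X" using X_mono[of 8] by simp
  from step[OF this] have D40: "40 * M \<le> D" by simp
  \<comment> \<open>The cube appears because only a third of a power of \<open>X\<close> will be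
    left over.\<close>
  have "(100 * (M + 1)) ^ 3 \<le> (200 * M) ^ 3" using M by (intro power_mono) auto
  also have "\<dots> = 8000000 * M ^ 3" by (simp add: power_mult_distrib)
  also have "\<dots> \<le> 3 * (40 * M) ^ 4 * 5"
  proof -
    have "M ^ 3 \<le> M ^ 4" using M by (intro power_increasing) auto
    moreover have "0 \<le> M ^ 4" by simp
    ultimately have "8000000 * M ^ 3 \<le> 38400000 * M ^ 4" by linarith
    then show ?thesis by (simp add: power_mult_distrib)
  qed
  also have "\<dots> \<le> X" using X_mono[OF _ D40] M by simp
  finally have X3: "(100 * (M + 1)) ^ 3 \<le> X" .
  have Xpos: "0 < X" using M D by (simp add: X_def)
  have "0 < (100 * (M + 1)) ^ 3" using M by simp
  then have "ln ((100 * (M + 1)) ^ 3) \<le> ln X" using X3 Xpos by (subst ln_le_cancel_iff)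
  then have ln3: "3 * ln (100 * (M + 1)) \<le> ln X" using M by (simp add: ln_realpow)
  have lnX0: "0 \<le> ln X" using lnX[of 0] \<open>3 ^ 2 \<le> X\<close> by simp
  have h0: "0 \<le> h" using h lnX0 M unfolding X_def by (smt (verit) mult_nonneg_nonneg)
  have "ln (2 * M / (2 * M + 1)) \<le> 2 * M / (2 * M + 1) - 1" using M by (intro ln_le_minus_one) auto
  also have "\<dots> = - 1 / (2 * M + 1)" using M by (simp add: field_simps)
  finally have "h * ln (2 * M / (2 * M + 1)) \<le> h * (- 1 / (2 * M + 1))"
    using h0 by (rule mult_left_mono)
  also have "\<dots> \<le> (4 * M * ln X) * (- 1 / (2 * M + 1))"
    using h M unfolding X_def by (intro mult_right_mono_neg) auto
  also have "\<dots> = - (4 * M / (2 * M + 1)) * ln X" using M by (simp add: field_simps)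
  also have "\<dots> \<le> - (4 / 3) * ln X"
    using M lnX0 by (intro mult_right_mono) (auto simp: field_simps)
  also have "\<dots> \<le> - ln X - ln (100 * (M + 1))" using ln3 by simp
  finally have "(2 * M / (2 * M + 1)) powr h \<le> exp (- ln X - ln (100 * (M + 1)))"
    using M by (simp add: powr_def)
  also have "\<dots> = 1 / (X * (100 * (M + 1)))"
    using Xpos M by (simp add: exp_diff exp_minus field_simps)
  finally have "X * (2 * M / (2 * M + 1)) powr h \<le> X * (1 / (X * (100 * (M + 1))))"
    using Xpos by (intro mult_left_mono) auto
  also have "\<dots> = 1 / (100 * (M + 1))" using Xpos by simp
  finally show ?thesis by (simp add: X_def mult.assoc)
qed

section \<open>Degree, boundary and Cheeger estimates\<close>

locale expander =
  fixes E :: "'v \<Rightarrow> 'v \<Rightarrow> bool" and white :: "'v \<Rightarrow> bool" and d :: nat and M :: int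
  assumes simple: "simple_graph E" and inf_UNIV: "infinite (UNIV :: 'v set)"
    and conn: "connected_graph E" and bip: "proper_bicolouring E white"
    and deg: "max_degree E d" and M1: "M \<ge> 1"
    and cheeger_ge: "cheeger E \<ge> 4 * real_of_int M * ln (3 * real d ^ 4 * (4 * real_of_int M + 1))"
begin

lemma E_sym: "E u v \<Longrightarrow> E v u"
  using simple unfolding simple_graph_def by blast

lemma E_irrefl: "\<not> E v v"
  using simple unfolding simple_graph_def by blast

lemma E_white: "E u v \<Longrightarrow> white u \<longleftrightarrow> \<not> white v"
  using bip unfolding proper_bicolouring_def by blast

lemma finite_nbrs: "finite (nbrs E v)" and card_nbrs: "card (nbrs E v) \<le> d"
  using deg unfolding max_degree_def by auto

text \<open>The punctured ball of radius two. Removing \<open>v\<close> from each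
  \<open>nbrs E x\<close> makes room for \<open>x\<close> itself, so each neighbour contributes at
  most \<open>d\<close> vertices and the total is at most \<open>d ^ 2\<close>.\<close>

definition N2 :: "'v \<Rightarrow> 'v set" where
  "N2 v = (\<Union>x\<in>nbrs E v. insert x (nbrs E x - {v}))"

lemma finite_N2: "finite (N2 v)"
  unfolding N2_def using finite_nbrs by auto

lemma card_N2: "card (N2 v) \<le> d ^ 2"
proof -
  have "card (insert x (nbrs E x - {v})) \<le> d" if "x \<in> nbrs E v" for x
  proof -
    have v: "v \<in> nbrs E x" using that E_sym by (simp add: nbrs_def)
    have "card (insert x (nbrs E x - {v})) \<le> Suc (card (nbrs E x - {v}))"
      by (simp add: card_insert_le_m1 card_insert_if finite_nbrs)
    also have "\<dots> = card (nbrs E x)" using v finite_nbrs by (metis card_Suc_Diff1)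
    finally show ?thesis using card_nbrs[of x] by simp
  qed
  then have "card (N2 v) \<le> (\<Sum>x\<in>nbrs E v. d)"
    unfolding N2_def using finite_nbrs
    by (intro order_trans[OF card_UN_le sum_mono]) auto
  also have "\<dots> \<le> d ^ 2" using card_nbrs by (simp add: power2_eq_square)
  finally show ?thesis .
qed

lemma N2_adj: "E v x \<Longrightarrow> x \<in> N2 v"
  unfolding N2_def nbrs_def by auto

lemma N2_adj2: "E v x \<Longrightarrow> E x y \<Longrightarrow> y \<noteq> v \<Longrightarrow> y \<in> N2 v"
  unfolding N2_def nbrs_def by auto

lemma finite_bdry: "finite S \<Longrightarrow> finite (bdry E S)"
  by (rule finite_subset[of _ "\<Union>u\<in>S. nbrs E u"]) (auto simp: bdry_def nbrs_def finite_nbrs[unfolded nbrs_def])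

text \<open>Otherwise the set would be closed under adjacency, and connectedness would make it the
  whole infinite vertex set.\<close>

lemma bdry_nonempty:
  assumes "finite S" "S \<noteq> {}"
  shows "bdry E S \<noteq> {}"
proof
  assume emp: "bdry E S = {}"
  obtain u where u: "u \<in> S" using assms by auto
  have "v \<in> S" if "(u, v) \<in> {(x, y). E x y}\<^sup>*" for v
    using that
  proof induction
    case (step y z)
    then show ?case using emp unfolding bdry_def by auto
  qed (rule u)
  then have "S = UNIV" using conn unfolding connected_graph_def by blast
  then show False using assms inf_UNIV by simp
qed

lemma cheeger_le: "finite S \<Longrightarrow> S \<noteq> {} \<Longrightarrow> cheeger E \<le> real (card (bdry E S)) / real (card S)"
  unfolding cheeger_def by (rule cInf_lower) (auto intro!: bdd_belowI[of _ 0])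

lemma cheeger_bdry: "finite S \<Longrightarrow> cheeger E * real (card S) \<le> real (card (bdry E S))"
  using cheeger_le[of S] by (cases "S = {}") (auto simp: field_simps card_gt_0_iff)

lemma cheeger_le_d: "cheeger E \<le> real d" and d_pos: "1 \<le> d"
proof -
  fix v :: 'v
  have sub: "bdry E {v} \<subseteq> nbrs E v" by (auto simp: bdry_def nbrs_def)
  have "card (bdry E {v}) \<le> d" using card_mono[OF finite_nbrs sub] card_nbrs[of v] by simp
  then show "cheeger E \<le> real d" using cheeger_le[of "{v}"] by simp
  have "0 < card (bdry E {v})" using bdry_nonempty[of "{v}"] finite_bdry[of "{v}"] by (simp add: card_gt_0_iff)
  then show "1 \<le> d" using \<open>card (bdry E {v}) \<le> d\<close> by simp
qed

text \<open>The fraction that survives when one of \<open>2 * M + 1\<close> values is forbidden; a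
  shorter range keeps an even smaller fraction.\<close>

definition shrink :: real where "shrink = 2 * real_of_int M / (2 * real_of_int M + 1)"

definition rho :: real where "rho = (4 * real_of_int M + 1) * shrink powr cheeger E"

text \<open>The weight of one new cluster vertex: \<open>d ^ 4\<close> for two steps of a walk,
  \<open>3\<close> for the ways of being bad in at least one of two samples, and \<open>rho\<close>
  for the probability.\<close>

definition decay :: real where "decay = 3 * real d ^ 4 * rho"

lemma shrink: "0 < shrink" "shrink < 1"
  using M1 by (auto simp: shrink_def)

lemma decay_le: "decay \<le> 1 / (100 * (real_of_int M + 1))"
  unfolding decay_def rho_def shrink_def
  using M1 d_pos cheeger_le_d cheeger_ge by (intro weight_bound) auto

lemma decay_small: "decay \<le> 1 / 200"
proof -
  have "1 / (100 * (real_of_int M + 1)) \<le> 1 / 200" using M1 by (simp add: field_simps)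
  then show ?thesis using decay_le by linarith
qed

lemma rho_pos: "0 < rho"
  unfolding rho_def using shrink M1 by (intro mult_pos_pos) auto

lemma decay_pos: "0 < decay"
  unfolding decay_def using rho_pos d_pos by auto

lemma rho_le_1: "rho \<le> 1"
proof -
  have "rho \<le> real d ^ 4 * rho" using d_pos rho_pos by simp
  moreover have "3 * (real d ^ 4 * rho) \<le> 1 / 200" using decay_small unfolding decay_def by (simp add: mult.assoc)
  ultimately show ?thesis using rho_pos by linarith
qed

text \<open>The only place where expansion meets counting: as \<open>shrink\<close> is below one, a
  larger boundary makes its power smaller.\<close>

lemma rho_power_ge:
  assumes "finite B"
  shows "(4 * real_of_int M + 1) ^ card B * shrink ^ card (bdry E B) \<le> rho ^ card B"
proof -
  have "shrink ^ card (bdry E B) = shrink powr real (card (bdry E B))" using shrink by (simp add: powr_realpow)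
  also have "\<dots> \<le> shrink powr (cheeger E * real (card B))"
    using shrink cheeger_bdry[OF assms] by (intro powr_mono') auto
  also have "\<dots> = (shrink powr cheeger E) ^ card B" using shrink by (simp add: powr_powr[symmetric] powr_realpow)
  finally show ?thesis using M1 unfolding rho_def power_mult_distrib by (intro mult_left_mono) auto
qed

end

section \<open>The Peierls estimate\<close>

locale ground = expander E white d M
  for E :: "'v \<Rightarrow> 'v \<Rightarrow> bool" and white :: "'v \<Rightarrow> bool" and d :: nat and M :: int +
  fixes a b :: int
  assumes a_le_b: "a \<le> b" and b_a: "b - a \<le> 2 * M"
begin

definition lo :: "'v \<Rightarrow> int" where "lo x = (if white x then a else b - M)"

definition hi :: "'v \<Rightarrow> int" where "hi x = (if white x then b else a + M)"

abbreviation C :: "'v set \<Rightarrow> ('v \<Rightarrow> int) set" where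
  "C U \<equiv> cfgs E white M a b U"

definition bad :: "'v set \<Rightarrow> ('v \<Rightarrow> int) \<Rightarrow> 'v set" where
  "bad U f = {x \<in> U. f x \<notin> {lo x..hi x}}"

lemma lo_hi: "lo x \<le> hi x" "hi x - lo x \<le> 2 * M"
  using a_le_b b_a by (auto simp: lo_def hi_def)

text \<open>The white and black intervals are dual: each consists of exactly those values within
  \<open>M\<close> of every value in the other. Hence good values are always compatible, while a bad
  value rules out an endpoint at every neighbour.\<close>

lemma lo_hi_adj: "E x y \<Longrightarrow> lo y = hi x - M" "E x y \<Longrightarrow> hi y = lo x + M"
  using E_white[of x y] by (auto simp: lo_def hi_def)

lemma good_adj: "E x y \<Longrightarrow> k \<in> {lo x..hi x} \<Longrightarrow> l \<in> {lo y..hi y} \<Longrightarrow> \<bar>k - l\<bar> \<le> M"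
  using lo_hi_adj[of x y] by auto

lemma cfgs_iff: "f \<in> C U \<longleftrightarrow> (\<forall>x. x \<notin> U \<union> bdry E U \<longrightarrow> f x = 0) \<and>
    (\<forall>u\<in>U \<union> bdry E U. \<forall>v\<in>U \<union> bdry E U. E u v \<longrightarrow> \<bar>f u - f v\<bar> \<le> M) \<and>
    (\<forall>v\<in>bdry E U. f v \<in> {lo v..hi v})"
  unfolding cfgs_def lip_on_def lo_def hi_def by auto

lemma cfgs_lip:
  "f \<in> C U \<Longrightarrow> u \<in> U \<union> bdry E U \<Longrightarrow> v \<in> U \<union> bdry E U \<Longrightarrow> E u v \<Longrightarrow> \<bar>f u - f v\<bar> \<le> M"
  unfolding cfgs_iff by simp

lemma adj_in_closure: "x \<in> U \<Longrightarrow> E x y \<Longrightarrow> y \<in> U \<union> bdry E U"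
  by (auto simp: bdry_def)

lemma good_if_not_bad: "f \<in> C U \<Longrightarrow> x \<in> U \<union> bdry E U \<Longrightarrow> x \<notin> bad U f \<Longrightarrow> f x \<in> {lo x..hi x}"
  by (cases "x \<in> U") (simp_all add: cfgs_iff bad_def)

lemma cfgsI:
  assumes "\<And>x. x \<notin> U \<union> bdry E U \<Longrightarrow> f x = 0"
    and "\<And>u v. u \<in> U \<union> bdry E U \<Longrightarrow> v \<in> U \<union> bdry E U \<Longrightarrow> E u v \<Longrightarrow> \<bar>f u - f v\<bar> \<le> M"
    and "\<And>v. v \<in> bdry E U \<Longrightarrow> f v \<in> {lo v..hi v}"
  shows "f \<in> C U"
  unfolding cfgs_iff using assms by simp

text \<open>Every nonempty subset of \<open>B\<close> has a neighbour outside, so the values on \<open>B\<close> can be revealed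
  one at a time, each next to a value already known or to the boundary.\<close>
lemma card_lipschitz_restrictions:
  assumes B: "finite B"
    and lip: "\<And>f u v. f \<in> F \<Longrightarrow> u \<in> B \<Longrightarrow> v \<in> B \<union> bdry E B \<Longrightarrow> E u v \<Longrightarrow> \<bar>f u - f v\<bar> \<le> M"
    and good: "\<And>f v. f \<in> F \<Longrightarrow> v \<in> bdry E B \<Longrightarrow> f v \<in> {lo v..hi v}"
  shows "finite ((\<lambda>f. restrict f B) ` F)"
    and "card ((\<lambda>f. restrict f B) ` F) \<le> nat (4 * M + 1) ^ card B"
proof -
  have "\<exists>S\<subseteq>B. card S = k \<and> finite ((\<lambda>f. restrict f S) ` F) \<and>
      card ((\<lambda>f. restrict f S) ` F) \<le> nat (4 * M + 1) ^ k" if "k \<le> card B" for k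
    using that
  proof (induction k)
    case 0
    have "(\<lambda>f. restrict f {}) ` F \<subseteq> {\<lambda>_. undefined}" by auto
    from finite_subset[OF this] card_mono[OF _ this]
    have "finite ((\<lambda>f. restrict f {}) ` F)" "card ((\<lambda>f. restrict f {}) ` F) \<le> nat (4 * M + 1) ^ 0"
      by simp_all
    then show ?case by (intro exI[of _ "{}"] conjI) (rule empty_subsetI card.empty | assumption)+
  next
    case (Suc k)
    then obtain S where S: "S \<subseteq> B" "card S = k" "finite ((\<lambda>f. restrict f S) ` F)"
      "card ((\<lambda>f. restrict f S) ` F) \<le> nat (4 * M + 1) ^ k" by (meson Suc_leD)
    have fS: "finite S" using S B finite_subset by blast
    have "B - S \<noteq> {}" using S Suc.prems by auto
    then have "bdry E (B - S) \<noteq> {}" using B by (intro bdry_nonempty) auto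
    then obtain x y where xy: "x \<in> B - S" "E x y" "y \<notin> B - S" unfolding bdry_def by auto
    \<comment> \<open>Reference value for revealing \<open>x\<close>: the value at \<open>y\<close>
      if already known, otherwise \<open>lo y\<close>. In the second case \<open>f y\<close> exceeds
      \<open>lo y\<close> by at most \<open>2 * M\<close>, so \<open>f x - lo y\<close> lies in
      \<open>{- M..3 * M}\<close>; this is the source of the \<open>4 * M + 1\<close>
      choices.\<close>
    define c where "c p = (if y \<in> S then p y else lo y)" for p :: "'v \<Rightarrow> int"
    let ?P = "(\<lambda>f. restrict f S) ` F \<times> {-M..3 * M}"
    have "(\<lambda>f. restrict f (insert x S)) ` F \<subseteq> (\<lambda>(p, t). p(x := c p + t)) ` ?P"
    proof
      fix p assume "p \<in> (\<lambda>f. restrict f (insert x S)) ` F"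
      then obtain f where f: "f \<in> F" "p = restrict f (insert x S)" by auto
      define t where "t = f x - c (restrict f S)"
      have "t \<in> {-M..3 * M}"
      proof (cases "y \<in> S")
        case True
        then have "\<bar>f x - f y\<bar> \<le> M" using lip[OF f(1)] xy S by auto
        then show ?thesis using True M1 by (auto simp: t_def c_def)
      next
        case False
        then have "y \<in> bdry E B" using xy by (auto simp: bdry_def)
        then have "\<bar>f x - f y\<bar> \<le> M" "f y \<in> {lo y..hi y}" using lip[OF f(1)] good[OF f(1)] xy by auto
        then show ?thesis using False lo_hi(2)[of y] M1 by (auto simp: t_def c_def)
      qed
      moreover have "p = (restrict f S)(x := c (restrict f S) + t)"
        by (auto simp: f t_def restrict_def fun_eq_iff)
      ultimately show "p \<in> (\<lambda>(p, t). p(x := c p + t)) ` ?P" using f(1) by (force simp: image_iff)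
    qed
    moreover have fP: "finite ?P" using S by auto
    ultimately have fin: "finite ((\<lambda>f. restrict f (insert x S)) ` F)"
      and le: "card ((\<lambda>f. restrict f (insert x S)) ` F) \<le> card ?P"
      using finite_subset[OF _ finite_imageI[OF fP]] surj_card_le[OF fP] by simp_all
    note le
    also have "card ?P = card ((\<lambda>f. restrict f S) ` F) * nat (4 * M + 1)"
      by (simp add: card_cartesian_product)
    also have "\<dots> \<le> nat (4 * M + 1) ^ k * nat (4 * M + 1)" using S by (intro mult_right_mono) auto
    finally have "card ((\<lambda>f. restrict f (insert x S)) ` F) \<le> nat (4 * M + 1) ^ Suc k"
      by (simp only: power_Suc mult.commute)
    moreover have "insert x S \<subseteq> B" "card (insert x S) = Suc k" using S xy fS by auto
    ultimately show ?case using fin by blast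
  qed
  from this[of "card B"] obtain S where "S \<subseteq> B" "card S = card B" "finite ((\<lambda>f. restrict f S) ` F)"
    "card ((\<lambda>f. restrict f S) ` F) \<le> nat (4 * M + 1) ^ card B" by blast
  moreover from this have "S = B" using B by (metis card_subset_eq)
  ultimately show "finite ((\<lambda>f. restrict f B) ` F)"
    "card ((\<lambda>f. restrict f B) ` F) \<le> nat (4 * M + 1) ^ card B" by blast+
qed

lemma finite_cfgs:
  assumes U: "finite U"
  shows "finite (C U)"
proof -
  have 1: "finite ((\<lambda>f. restrict f U) ` C U)"
    by (rule card_lipschitz_restrictions[OF U]) (auto simp: cfgs_iff)
  have "(\<lambda>f. restrict f (bdry E U)) ` C U \<subseteq> PiE (bdry E U) (\<lambda>v. {lo v..hi v})"
    by (auto simp: cfgs_iff)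
  then have 2: "finite ((\<lambda>f. restrict f (bdry E U)) ` C U)"
    using finite_PiE[OF finite_bdry[OF U], of "\<lambda>v. {lo v..hi v}"] finite_subset by blast
  have "inj_on (\<lambda>f. (restrict f U, restrict f (bdry E U))) (C U)"
  proof (rule inj_onI, rule ext)
    fix f g x
    assume f: "f \<in> C U" and g: "g \<in> C U"
      and eq: "(restrict f U, restrict f (bdry E U)) = (restrict g U, restrict g (bdry E U))"
    then have eq: "restrict f U x = restrict g U x" "restrict f (bdry E U) x = restrict g (bdry E U) x" by auto
    show "f x = g x"
    proof (cases "x \<in> U \<union> bdry E U")
      case True
      then show ?thesis using eq by (auto simp: restrict_def split: if_splits)
    next
      case False
      then show ?thesis using f g unfolding cfgs_iff by simp
    qed
  qed
  moreover have "finite ((\<lambda>f. (restrict f U, restrict f (bdry E U))) ` C U)"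
    by (rule finite_subset[OF _ finite_cartesian_product[OF 1 2]]) auto
  ultimately show ?thesis using finite_imageD by blast
qed

lemma cfgs_nonempty: "C U \<noteq> {}"
proof -
  have "(\<lambda>x. if x \<in> U \<union> bdry E U then lo x else 0) \<in> C U"
    using lo_hi(1) good_adj by (intro cfgsI) auto
  then show ?thesis by blast
qed

lemma card_cfgs_pos: "finite U \<Longrightarrow> 0 < card (C U)"
  using finite_cfgs cfgs_nonempty by (simp add: card_gt_0_iff)

text \<open>Here \<open>B\<close> need not be connected: it is any union of components of the bad
  set for steps of length at most two. The first two layers around \<open>B\<close> inside the
  domain are therefore good.\<close>

definition isolated_bad :: "'v set \<Rightarrow> 'v set \<Rightarrow> ('v \<Rightarrow> int) set" where
  "isolated_bad U B = {f \<in> C U. B \<subseteq> bad U f \<and> (\<forall>x\<in>B. N2 x \<inter> bad U f \<subseteq> B)}"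

lemma isolated_bad_near_good:
  assumes f: "f \<in> isolated_bad U B" and y: "y \<in> U \<union> bdry E U" "y \<notin> B" and x: "x \<in> B" "y \<in> N2 x"
  shows "f y \<in> {lo y..hi y}"
  using assms by (intro good_if_not_bad[of f U]) (auto simp: isolated_bad_def)

text \<open>Overwriting \<open>B\<close> by good values frees all of \<open>S0\<close> on the
  boundary \<open>D\<close>. Remembering the erased values makes this injective, at the cost of the
  factor \<open>card T\<close>. On \<open>B\<close> that cost is at most \<open>4 * M + 1\<close>
  per vertex, and on \<open>D\<close> one value per vertex was forbidden, so \<open>T\<close> falls
  short of \<open>S0\<close> by a factor \<open>shrink\<close> for each vertex of
  \<open>D\<close>.\<close>

lemma card_isolated_bad_le:
  assumes U: "finite U"
  shows "real (card (isolated_bad U B)) \<le> rho ^ card B * real (card (C U))"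
proof (cases "B \<subseteq> U")
  case False
  then have "isolated_bad U B = {}" by (auto simp: isolated_bad_def bad_def)
  then show ?thesis using rho_pos by simp
next
  case True
  then have B: "finite B" using U finite_subset by blast
  define D where "D = bdry E B"
  have D: "finite D" unfolding D_def using B by (rule finite_bdry)
  have BD: "B \<inter> D = {}" "B \<union> D \<subseteq> U \<union> bdry E U"
    using True by (auto simp: D_def bdry_def)
  define S0 where "S0 = PiE D (\<lambda>v. {lo v..hi v})"
  define T where "T = (\<lambda>f. (restrict f B, restrict f D)) ` isolated_bad U B"
  \<comment> \<open>The first component is the repaired configuration, with the free choice
    \<open>s\<close> on \<open>D\<close>; the second stores what was overwritten.\<close>
  define \<Phi> where "\<Phi> = (\<lambda>(f, s). ((\<lambda>x. if x \<in> B then lo x else if x \<in> D then s x else f x),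
      (restrict f B, restrict f D)) :: ('v \<Rightarrow> int) \<times> ('v \<Rightarrow> int) \<times> ('v \<Rightarrow> int))"
  have ib_C: "isolated_bad U B \<subseteq> C U" by (auto simp: isolated_bad_def)
  have fin_ib: "finite (isolated_bad U B)" using ib_C finite_cfgs[OF U] finite_subset by blast
  have D_good: "f v \<in> {lo v..hi v}" if "f \<in> isolated_bad U B" "v \<in> D" for f v
  proof -
    obtain x where x: "x \<in> B" "E x v" "v \<notin> B" using \<open>v \<in> D\<close> by (auto simp: D_def bdry_def)
    show ?thesis using BD \<open>v \<in> D\<close> by (intro isolated_bad_near_good[OF that(1) _ x(3,1) N2_adj[OF x(2)]]) blast
  qed
  have into: "(\<lambda>x. if x \<in> B then lo x else if x \<in> D then s x else f x) \<in> C U" (is "?g \<in> _")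
    if f: "f \<in> isolated_bad U B" and s: "s \<in> S0" for f s
  proof -
    have fC: "f \<in> C U" using f ib_C by blast
    have gg: "?g x \<in> {lo x..hi x}" if "x \<in> B \<union> D" for x
      using that lo_hi(1)[of x] s unfolding S0_def PiE_iff by auto
    have out: "?g x = f x" if "x \<notin> B \<union> D" for x using that by auto
    \<comment> \<open>Edges leaving the overwritten region start in \<open>D\<close>, so they end
      within distance two of \<open>B\<close>, where isolation makes the old value good.\<close>
    have near: "f v \<in> {lo v..hi v}" if "u \<in> B \<union> D" "v \<notin> B \<union> D" "E u v" "v \<in> U \<union> bdry E U" for u v
    proof -
      have "u \<in> D" using that by (auto simp: D_def bdry_def)
      then obtain x where x: "x \<in> B" "E x u" by (auto simp: D_def bdry_def)
      then have "v \<in> N2 x" using that by (intro N2_adj2[of x u]) auto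
      then show ?thesis using isolated_bad_near_good[OF f that(4) _ x(1)] that by blast
    qed
    show ?thesis
    proof (rule cfgsI)
      fix x assume "x \<notin> U \<union> bdry E U"
      then have "x \<notin> B \<union> D" "f x = 0" using BD(2) fC unfolding cfgs_iff by blast+
      then show "?g x = 0" by auto
    next
      fix v assume v: "v \<in> bdry E U"
      then have "f v \<in> {lo v..hi v}" using fC unfolding cfgs_iff by blast
      then show "?g v \<in> {lo v..hi v}" using gg[of v] out[of v] by (cases "v \<in> B \<union> D") simp_all
    next
      fix u v assume uv: "u \<in> U \<union> bdry E U" "v \<in> U \<union> bdry E U" "E u v"
      consider "u \<in> B \<union> D" "v \<in> B \<union> D" | "u \<in> B \<union> D" "v \<notin> B \<union> D" | "u \<notin> B \<union> D" "v \<in> B \<union> D"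
        | "u \<notin> B \<union> D" "v \<notin> B \<union> D" by blast
      then show "\<bar>?g u - ?g v\<bar> \<le> M"
      proof cases
        case 1
        show ?thesis by (rule good_adj[OF uv(3) gg[OF 1(1)] gg[OF 1(2)]])
      next
        case 2
        show ?thesis unfolding out[OF 2(2)] by (rule good_adj[OF uv(3) gg[OF 2(1)] near[OF 2 uv(3,2)]])
      next
        case 3
        show ?thesis unfolding out[OF 3(1)]
          by (rule good_adj[OF uv(3) near[OF 3(2,1) E_sym[OF uv(3)] uv(1)] gg[OF 3(2)]])
      next
        case 4
        show ?thesis unfolding out[OF 4(1)] out[OF 4(2)] using uv fC unfolding cfgs_iff by blast
      qed
    qed
  qed
  have "inj_on \<Phi> (isolated_bad U B \<times> S0)"
  proof (rule inj_onI)
    fix p q assume p: "p \<in> isolated_bad U B \<times> S0" and q: "q \<in> isolated_bad U B \<times> S0" and eq: "\<Phi> p = \<Phi> q"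
    obtain f s f' s' where ps: "p = (f, s)" "q = (f', s')" by fastforce
    have e1: "(if x \<in> B then lo x else if x \<in> D then s x else f x) =
        (if x \<in> B then lo x else if x \<in> D then s' x else f' x)" for x
      using fun_cong[OF arg_cong[OF eq, of fst], of x] unfolding ps \<Phi>_def by simp
    have e2: "restrict f B x = restrict f' B x" "restrict f D x = restrict f' D x" for x
      using eq unfolding ps \<Phi>_def by (auto dest: fun_cong)
    have "f = f'"
    proof
      fix x show "f x = f' x" using e1[of x] e2[of x] by (auto split: if_splits)
    qed
    moreover have "s = s'"
    proof (rule PiE_ext)
      show "s \<in> PiE D (\<lambda>v. {lo v..hi v})" "s' \<in> PiE D (\<lambda>v. {lo v..hi v})"
        using p q unfolding ps S0_def by auto
      show "s x = s' x" if "x \<in> D" for x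
      proof -
        have "x \<notin> B" using that BD by blast
        then show ?thesis using e1[of x] that by simp
      qed
    qed
    ultimately show "p = q" by (simp add: ps)
  qed
  moreover have "\<Phi> ` (isolated_bad U B \<times> S0) \<subseteq> C U \<times> T"
    using into by (auto simp: \<Phi>_def T_def)
  moreover have finT: "finite T" unfolding T_def using fin_ib by simp
  ultimately have "card (isolated_bad U B \<times> S0) \<le> card (C U \<times> T)"
    using finite_cfgs[OF U] by (intro card_inj_on_le) auto
  then have main: "real (card (isolated_bad U B)) * real (card S0) \<le> real (card (C U)) * real (card T)"
    by (simp add: card_cartesian_product flip: of_nat_mult)
  \<comment> \<open>The value lost at \<open>v\<close>: a chosen neighbour \<open>x\<close> in
    \<open>B\<close> is bad, and if its value is above \<open>hi x\<close> then \<open>v\<close>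
    cannot take \<open>lo v\<close>, while if it is below \<open>lo x\<close> then \<open>v\<close>
    cannot take \<open>hi v\<close>. It depends only on the values on \<open>B\<close>, so
    \<open>T\<close> can be counted fibrewise.\<close>
  define ex where "ex p v = (let x = SOME x. x \<in> B \<and> E x v in if hi x < p x then lo v else hi v)"
    for p :: "'v \<Rightarrow> int" and v
  have ex_in: "ex p v \<in> {lo v..hi v}" for p v using lo_hi(1) by (auto simp: ex_def Let_def)
  let ?R = "(\<lambda>f. restrict f B) ` isolated_bad U B"
  have "T \<subseteq> (SIGMA p:?R. PiE D (\<lambda>v. {lo v..hi v} - {ex p v}))"
  proof -
    have "f v \<noteq> ex (restrict f B) v" if f: "f \<in> isolated_bad U B" and v: "v \<in> D" for f v
    proof -
      define x where "x = (SOME x. x \<in> B \<and> E x v)"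
      have "\<exists>x. x \<in> B \<and> E x v" using v by (auto simp: D_def bdry_def)
      then have x: "x \<in> B" "E x v" unfolding x_def by (metis (mono_tags, lifting) someI_ex)+
      have "f x \<notin> {lo x..hi x}" using f x(1) by (auto simp: isolated_bad_def bad_def)
      moreover have "\<bar>f x - f v\<bar> \<le> M"
        using f x(1) v BD ib_C by (intro cfgs_lip[OF _ _ _ x(2)]) auto
      ultimately show ?thesis using lo_hi_adj[OF x(2)] x(1)
        unfolding ex_def Let_def x_def[symmetric] by auto
    qed
    then show ?thesis using D_good unfolding T_def by fastforce
  qed
  moreover have finR: "finite ?R" using fin_ib by simp
  ultimately have "card T \<le> card (SIGMA p:?R. PiE D (\<lambda>v. {lo v..hi v} - {ex p v}))"
    using D by (intro card_mono finite_SigmaI finite_PiE) auto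
  also have "\<dots> = (\<Sum>p\<in>?R. \<Prod>v\<in>D. card ({lo v..hi v} - {ex p v}))"
    using finR D by (subst card_SigmaI) (auto intro!: finite_PiE simp: card_PiE)
  finally have "real (card T) \<le> (\<Sum>p\<in>?R. \<Prod>v\<in>D. real (card ({lo v..hi v} - {ex p v})))"
    by (simp flip: of_nat_prod of_nat_sum)
  also have "\<dots> \<le> (\<Sum>p\<in>?R. \<Prod>v\<in>D. shrink * real (card {lo v..hi v}))"
  proof (intro sum_mono prod_mono conjI)
    fix p v
    have "real (card ({lo v..hi v} - {ex p v})) = real (card {lo v..hi v}) - 1"
      using ex_in[of p v] card_gt_0_iff[of "{lo v..hi v}"] by (subst card_Diff_singleton) (auto simp: of_nat_diff)
    also have "\<dots> \<le> shrink * real (card {lo v..hi v})"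
      using lo_hi[of v] M1 unfolding shrink_def by (simp add: field_simps)
    finally show "real (card ({lo v..hi v} - {ex p v})) \<le> shrink * real (card {lo v..hi v})" .
  qed auto
  also have "\<dots> = real (card ?R) * (shrink ^ card D * real (card S0))"
    using D by (simp add: prod.distrib S0_def card_PiE)
  also have "\<dots> \<le> (4 * real_of_int M + 1) ^ card B * (shrink ^ card D * real (card S0))"
  proof (intro mult_right_mono)
    have "card ?R \<le> nat (4 * M + 1) ^ card B"
    proof (rule card_lipschitz_restrictions(2)[OF B])
      fix f u v assume "f \<in> isolated_bad U B" "u \<in> B" "v \<in> B \<union> bdry E B" "E u v"
      then show "\<bar>f u - f v\<bar> \<le> M" using ib_C BD unfolding D_def by (intro cfgs_lip[of f U]) auto
    qed (use D_good D_def in auto)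
    then have "real (card ?R) \<le> real (nat (4 * M + 1) ^ card B)" by (simp only: of_nat_le_iff)
    also have "\<dots> = (4 * real_of_int M + 1) ^ card B" using M1 by simp
    finally show "real (card ?R) \<le> (4 * real_of_int M + 1) ^ card B" .
  qed (use shrink in auto)
  also have "\<dots> \<le> rho ^ card B * real (card S0)"
    using rho_power_ge[OF B] unfolding D_def mult.assoc[symmetric] by (intro mult_right_mono) auto
  finally have "real (card (isolated_bad U B)) * real (card S0) \<le> real (card (C U)) * (rho ^ card B * real (card S0))"
    using main by (meson mult_left_mono of_nat_0_le_iff order_trans)
  moreover have "0 < real (card S0)"
  proof -
    have "S0 \<noteq> {}" unfolding S0_def using lo_hi(1) by (auto simp: PiE_eq_empty_iff)
    then show ?thesis unfolding S0_def using D by (simp add: card_gt_0_iff finite_PiE)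
  qed
  ultimately show ?thesis by (simp add: mult.left_commute mult.commute)
qed

end

section \<open>Clusters of bad vertices\<close>

context expander
begin

lemma N2_sym: "y \<in> N2 x \<Longrightarrow> x \<in> N2 y"
  unfolding N2_def nbrs_def using E_sym by blast

text \<open>Walks in the graph whose edges are pairs at distance one or two; \<open>l\<close> counts
  steps, hence the \<open>Suc\<close> in the list length.\<close>

definition walks :: "'v \<Rightarrow> nat \<Rightarrow> 'v list set" where
  "walks r l = {w. length w = Suc l \<and> hd w = r \<and> successively (\<lambda>x y. y \<in> N2 x) w}"

lemma card_walks: "finite (walks r l) \<and> card (walks r l) \<le> (d ^ 2) ^ l"
proof (induction l arbitrary: r)
  case 0
  have "walks r 0 = {[r]}" by (auto simp: walks_def length_Suc_conv)
  then show ?case by simp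
next
  case (Suc l)
  have sub: "walks r (Suc l) \<subseteq> (\<Union>y\<in>N2 r. (#) r ` walks y l)"
  proof
    fix w assume w: "w \<in> walks r (Suc l)"
    then obtain y ys where *: "w = r # y # ys" by (auto simp: walks_def length_Suc_conv)
    then have "y \<in> N2 r" "y # ys \<in> walks y l" using w by (auto simp: walks_def)
    then show "w \<in> (\<Union>y\<in>N2 r. (#) r ` walks y l)" unfolding * by blast
  qed
  have fin: "finite (\<Union>y\<in>N2 r. (#) r ` walks y l)" using Suc.IH finite_N2 by auto
  have "card (walks r (Suc l)) \<le> card (\<Union>y\<in>N2 r. (#) r ` walks y l)" by (rule card_mono[OF fin sub])
  also have "\<dots> \<le> (\<Sum>y\<in>N2 r. card ((#) r ` walks y l))" by (rule card_UN_le[OF finite_N2])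
  also have "\<dots> \<le> (\<Sum>y\<in>N2 r. (d ^ 2) ^ l)"
    using Suc.IH by (intro sum_mono) (meson card_image_le order_trans)
  also have "\<dots> \<le> (d ^ 2) ^ Suc l" using card_N2[of r] by simp
  finally show ?case using finite_subset[OF sub fin] by blast
qed

text \<open>A round trip from \<open>x\<close> to \<open>y\<close> and back costs two steps, each
  with at most \<open>d ^ 2\<close> choices. This produces the \<open>d ^ 4\<close> per cluster
  vertex.\<close>

lemma walk_detour:
  assumes w: "w \<in> walks r l" and x: "x \<in> set w" and y: "y \<in> N2 x"
  shows "\<exists>w'\<in>walks r (l + 2). set w' = insert y (set w)"
proof -
  obtain us vs where uv: "w = us @ x # vs" using x by (meson split_list)
  have "us @ x # y # x # vs \<in> walks r (l + 2)"
    using w y N2_sym[OF y] unfolding uv walks_def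
    by (cases us; cases vs) (auto simp: successively_append_iff successively_Cons hd_append split: if_splits)
  then show ?thesis by (intro bexI[of _ "us @ x # y # x # vs"]) (auto simp: uv)
qed

text \<open>By connectedness a walk can be prolonged to visit any further vertex. A finite set can
  thus be enlarged to the trace of one walk, and clusters seeded by it can be counted from a single
  root.\<close>

lemma walk_covering:
  assumes "finite A"
  shows "\<exists>r l. \<exists>w\<in>walks r l. A \<subseteq> set w"
  using assms
proof (induction A)
  case empty
  then show ?case by simp (metis (mono_tags, lifting) length_Cons list.sel(1) list.size(3) mem_Collect_eq successively.simps(2) walks_def)
next
  case (insert x A)
  then obtain r l w where w: "w \<in> walks r l" "A \<subseteq> set w" by blast
  have "\<exists>l'. \<exists>w'\<in>walks r l'. A \<subseteq> set w' \<and> last w' = v" if "(last w, v) \<in> {(x, y). E x y}\<^sup>*" for v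
    using that
  proof induction
    case base
    then show ?case using w by blast
  next
    case (step y z)
    then obtain l' w' where w': "w' \<in> walks r l'" "A \<subseteq> set w'" "last w' = y" by blast
    have "w' \<noteq> []" using w'(1) by (auto simp: walks_def)
    then have "w' @ [z] \<in> walks r (Suc l')"
      using w' step.hyps(2) N2_adj[of y z] by (auto simp: walks_def successively_append_iff)
    then show ?case using w' by (intro exI[of _ "Suc l'"] bexI[of _ "w' @ [z]"]) auto
  qed
  from this[of x] obtain l' w' where w': "w' \<in> walks r l'" "A \<subseteq> set w'" "last w' = x"
    using conn unfolding connected_graph_def by blast
  then have "w' \<noteq> []" by (auto simp: walks_def)
  then show ?case using w' last_in_set by blast
qed

text \<open>All of \<open>A\<close> is included, whether in \<open>X\<close> or not, so that the
  later exchange of two samples acts on every vertex of \<open>A\<close>.\<close>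

inductive_set cluster :: "'v set \<Rightarrow> 'v set \<Rightarrow> 'v set" for A X where
  base: "x \<in> A \<Longrightarrow> x \<in> cluster A X"
| step: "x \<in> cluster A X \<Longrightarrow> y \<in> N2 x \<Longrightarrow> y \<in> X \<Longrightarrow> y \<in> cluster A X"

lemma cluster_subset: "cluster A X \<subseteq> A \<union> X"
proof
  show "x \<in> A \<union> X" if "x \<in> cluster A X" for x using that by induction auto
qed

text \<open>The ball of radius \<open>2 * n\<close> around \<open>A\<close> in graph
  distance.\<close>

primrec reach :: "'v set \<Rightarrow> nat \<Rightarrow> 'v set" where
  "reach A 0 = A"
| "reach A (Suc n) = reach A n \<union> (\<Union>x\<in>reach A n. N2 x)"

lemma finite_reach: "finite A \<Longrightarrow> finite (reach A n)"
  by (induction n) (auto simp: finite_N2)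

lemma reach_mono: "m \<le> n \<Longrightarrow> reach A m \<subseteq> reach A n"
  by (induction n) (auto simp: le_Suc_eq)

text \<open>Starting from \<open>w0\<close>, each new cluster vertex is picked up by one detour. The
  resulting walk encodes the cluster's shape, and \<open>k\<close> detours cannot leave
  \<open>reach A k\<close>.\<close>

lemma cluster_walk:
  assumes w0: "w0 \<in> walks r l" and X: "finite X"
  defines "A \<equiv> set w0"
  shows "\<exists>w\<in>walks r (l + 2 * card (cluster A X - A)). set w = cluster A X"
    and "cluster A X \<subseteq> reach A (card (cluster A X - A))"
proof -
  let ?K = "cluster A X"
  have fK: "finite (?K - A)" using X cluster_subset[of A X] finite_subset by (metis Diff_subset_conv)
  have AK: "A \<subseteq> ?K" by (auto intro: cluster.base)
  have "\<exists>w\<in>walks r (l + 2 * k). A \<subseteq> set w \<and> set w \<subseteq> ?K \<and> set w \<subseteq> reach A k \<and> card (set w - A) = k"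
    if "k \<le> card (?K - A)" for k
    using that
  proof (induction k)
    case 0
    then show ?case using w0 AK by (auto simp: A_def)
  next
    case (Suc k)
    then obtain w where w: "w \<in> walks r (l + 2 * k)" "A \<subseteq> set w" "set w \<subseteq> ?K"
      "set w \<subseteq> reach A k" "card (set w - A) = k" by (meson Suc_leD)
    have "set w \<noteq> ?K" using w(5) Suc.prems by auto
    \<comment> \<open>Otherwise the visited set would be closed under the rules generating the
      cluster and would already exhaust it.\<close>
    have "\<exists>x\<in>set w. \<exists>y\<in>N2 x. y \<in> ?K - set w"
    proof (rule ccontr)
      assume neg: "\<not> ?thesis"
      have "x \<in> set w" if "x \<in> ?K" for x
        using that
      proof induction
        case (base x)
        then show ?case using w by blast
      next
        case (step x y)
        then show ?case using neg cluster.step[of x A X y] by blast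
      qed
      then show False using w(3) \<open>set w \<noteq> ?K\<close> by blast
    qed
    then obtain x y where xy: "x \<in> set w" "y \<in> N2 x" "y \<in> ?K - set w" by blast
    obtain w' where w': "w' \<in> walks r (l + 2 * k + 2)" "set w' = insert y (set w)"
      using walk_detour[OF w(1) xy(1,2)] by blast
    have "y \<in> reach A (Suc k)" using xy w(4) by auto
    moreover have "set w' - A = insert y (set w - A)" using w' xy w(2) by auto
    then have "card (set w' - A) = Suc k" using xy w(5) by simp
    ultimately show ?case using w w' xy by (intro bexI[of _ w']) auto
  qed
  from this[of "card (?K - A)"] obtain w where w: "w \<in> walks r (l + 2 * card (?K - A))" "A \<subseteq> set w"
    "set w \<subseteq> ?K" "set w \<subseteq> reach A (card (?K - A))" "card (set w - A) = card (?K - A)" by blast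
  have "set w - A = ?K - A" using w by (intro card_subset_eq[OF fK]) auto
  then have "set w = ?K" using w AK by blast
  then show "\<exists>w\<in>walks r (l + 2 * card (?K - A)). set w = ?K"
    and "?K \<subseteq> reach A (card (?K - A))" using w by auto
qed

end

text \<open>Membership of a vertex in the two sets has four possible patterns; outside
  \<open>A\<close> the pattern of belonging to neither is excluded, which leaves three.\<close>

lemma card_covering_pairs:
  assumes S: "finite S" and A: "A \<subseteq> S"
  defines "Q \<equiv> {(B1, B2). B1 \<subseteq> S \<and> B2 \<subseteq> S \<and> S - A \<subseteq> B1 \<union> B2}"
  shows "finite Q" and "card Q \<le> 4 ^ card A * 3 ^ card (S - A)"
proof -
  show "finite Q" unfolding Q_def
    by (rule finite_subset[of _ "Pow S \<times> Pow S"]) (use S in auto)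
  define R where "R = PiE S (\<lambda>x. if x \<in> A then UNIV else UNIV - {(False, False)})"
  have fA: "finite A" using S A finite_subset by blast
  have fR: "finite R" unfolding R_def using S by (intro finite_PiE) auto
  have "inj_on (\<lambda>(B1, B2). \<lambda>x\<in>S. (x \<in> B1, x \<in> B2)) Q"
  proof (rule inj_onI, clarify)
    fix B1 B2 B1' B2'
    assume *: "(B1, B2) \<in> Q" "(B1', B2') \<in> Q"
      and eq: "(\<lambda>x\<in>S. (x \<in> B1, x \<in> B2)) = (\<lambda>x\<in>S. (x \<in> B1', x \<in> B2'))"
    have "(x \<in> B1) = (x \<in> B1') \<and> (x \<in> B2) = (x \<in> B2')" if "x \<in> S" for x
      using fun_cong[OF eq, of x] that by simp
    then show "B1 = B1' \<and> B2 = B2'" using * unfolding Q_def by blast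
  qed
  moreover have "(\<lambda>(B1, B2). \<lambda>x\<in>S. (x \<in> B1, x \<in> B2)) ` Q \<subseteq> R"
    by (auto simp: Q_def R_def)
  ultimately have "card Q \<le> card R" using fR by (rule card_inj_on_le)
  also have "card R = (\<Prod>x\<in>S. if x \<in> A then 4 else 3)"
    unfolding R_def using S by (subst card_PiE) (auto intro!: prod.cong simp: card_Diff_singleton card_UNIV_bool card_prod simp flip: UNIV_Times_UNIV)
  also have "\<dots> = 4 ^ card A * 3 ^ card (S - A)"
  proof -
    have "S \<inter> {x. x \<in> A} = A" "S \<inter> - {x. x \<in> A} = S - A" using A by auto
    then show ?thesis using S by (simp add: prod.If_cases)
  qed
  finally show "card Q \<le> 4 ^ card A * 3 ^ card (S - A)" .
qed

context ground
begin

text \<open>The cluster absorbs every vertex of \<open>X\<close> within distance two of it, so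
  neither sample has further bad vertices nearby and the Peierls bound applies to each
  sample.\<close>

lemma cluster_isolated_bad:
  assumes "f \<in> C U" and "bad U f \<subseteq> X"
  shows "f \<in> isolated_bad U (cluster A X \<inter> bad U f)"
  using assms unfolding isolated_bad_def by (auto intro: cluster.step)

definition large_cluster :: "'v set \<Rightarrow> 'v set \<Rightarrow> 'v set \<Rightarrow> nat \<Rightarrow> (('v \<Rightarrow> int) \<times> ('v \<Rightarrow> int)) set" where
  "large_cluster U W A N = {(f, g) \<in> C U \<times> C W. N \<le> card (cluster A (bad U f \<union> bad W g) - A)}"

text \<open>A union bound over the walk tracing the cluster and the splitting of its vertices into
  those bad in the first and in the second sample. The prefactor pays for the initial walk and for
  the patterns on \<open>A\<close>; the rest is a geometric series in \<open>decay\<close>.\<close>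

lemma card_large_cluster_le:
  assumes U: "finite U" and W: "finite W" and w0: "w0 \<in> walks r l"
  defines "A \<equiv> set w0"
  shows "real (card (large_cluster U W A N)) \<le>
    4 ^ card A * (real d ^ 2) ^ l * (decay ^ N / (1 - decay)) * (real (card (C U)) * real (card (C W)))"
proof -
  \<comment> \<open>New cluster vertices are bad, hence lie in \<open>U \<union> W\<close>;
    \<open>J\<close> merely makes the sum finite.\<close>
  define J where "J = card (U \<union> W)"
  define Ws where "Ws j = {w \<in> walks r (l + 2 * j). A \<subseteq> set w \<and> card (set w - A) = j}" for j
  define Q where "Q w = {(B1, B2). B1 \<subseteq> set w \<and> B2 \<subseteq> set w \<and> set w - A \<subseteq> B1 \<union> B2}" for w
  define Z where "Z p = isolated_bad U (fst p) \<times> isolated_bad W (snd p)" for p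
  let ?CC = "real (card (C U)) * real (card (C W))"
  have fbad: "finite (bad U f \<union> bad W g)" for f g using U W by (auto simp: bad_def)
  have finZ: "finite (Z p)" for p
    unfolding Z_def using finite_cfgs[OF U] finite_cfgs[OF W]
    by (intro finite_cartesian_product finite_subset[of "isolated_bad U _" "C U"] finite_subset[of "isolated_bad W _" "C W"]) (auto simp: isolated_bad_def)
  have finWs: "finite (Ws j)" for j unfolding Ws_def using card_walks by simp
  have finQ: "finite (Q w)" and cardQ: "card (Q w) \<le> 4 ^ card A * 3 ^ j" if "w \<in> Ws j" for w j
    using card_covering_pairs[of "set w" A] that unfolding Q_def Ws_def by auto
  have cover: "large_cluster U W A N \<subseteq> (\<Union>j\<in>{N..J}. \<Union>w\<in>Ws j. \<Union>p\<in>Q w. Z p)"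
  proof (clarsimp simp: large_cluster_def)
    fix f g
    assume f: "f \<in> C U" and g: "g \<in> C W" and N: "N \<le> card (cluster A (bad U f \<union> bad W g) - A)"
    define X where "X = bad U f \<union> bad W g"
    define K where "K = cluster A X"
    have X: "finite X" unfolding X_def by (rule fbad)
    have KX: "K - A \<subseteq> X" unfolding K_def using cluster_subset by blast
    have "X \<subseteq> U \<union> W" by (auto simp: X_def bad_def)
    then have le: "card (K - A) \<le> J" unfolding J_def using KX U W by (intro card_mono) auto
    obtain w where w: "w \<in> walks r (l + 2 * card (K - A))" "set w = K"
      using cluster_walk(1)[OF w0 X] unfolding K_def A_def by blast
    have "A \<subseteq> K" unfolding K_def by (auto intro: cluster.base)
    then have "w \<in> Ws (card (K - A))" using w by (auto simp: Ws_def)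
    moreover have "(K \<inter> bad U f, K \<inter> bad W g) \<in> Q w" using KX by (auto simp: Q_def w X_def)
    moreover have "(f, g) \<in> Z (K \<inter> bad U f, K \<inter> bad W g)"
      using cluster_isolated_bad[OF f, of X A] cluster_isolated_bad[OF g, of X A] by (auto simp: Z_def K_def X_def)
    moreover have "card (K - A) \<in> {N..J}" using N le by (simp add: K_def X_def)
    ultimately show "\<exists>x\<in>{N..J}. \<exists>w\<in>Ws x. \<exists>x\<in>Q w. (f, g) \<in> Z x" by blast
  qed
  have cardZ: "real (card (Z p)) \<le> rho ^ j * ?CC" if w: "w \<in> Ws j" and p: "p \<in> Q w" for w j p
  proof -
    obtain B1 B2 where p': "p = (B1, B2)" by fastforce
    have fin: "finite B1" "finite B2" using p unfolding p' Q_def by (auto intro: finite_subset)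
    have "j = card (set w - A)" using w by (simp add: Ws_def)
    also have "\<dots> \<le> card (B1 \<union> B2)" using p fin unfolding p' Q_def by (intro card_mono) auto
    also have "\<dots> \<le> card B1 + card B2" by (rule card_Un_le)
    finally have j: "j \<le> card B1 + card B2" .
    have "real (card (Z p)) = real (card (isolated_bad U B1)) * real (card (isolated_bad W B2))"
      by (simp add: Z_def p' card_cartesian_product)
    also have "\<dots> \<le> (rho ^ card B1 * real (card (C U))) * (rho ^ card B2 * real (card (C W)))"
      using card_isolated_bad_le[OF U] card_isolated_bad_le[OF W] rho_pos by (intro mult_mono) auto
    also have "\<dots> = rho ^ (card B1 + card B2) * ?CC" by (simp add: power_add)
    \<comment> \<open>Vertices bad in both samples, and those in \<open>A\<close>, may make the
      exponent larger than \<open>j\<close>; since \<open>rho \<le> 1\<close> this only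
      helps.\<close>
    also have "\<dots> \<le> rho ^ j * ?CC"
      using j rho_pos rho_le_1 by (intro mult_right_mono power_decreasing) auto
    finally show ?thesis .
  qed
  have UN_le: "real (card (\<Union>i\<in>I. B i)) \<le> (\<Sum>i\<in>I. real (card (B i)))" if "finite I"
    for I :: "'i set" and B :: "'i \<Rightarrow> 'j set"
    using card_UN_le[OF that, of B] by (simp flip: of_nat_sum)
  have "real (card (large_cluster U W A N)) \<le> real (card (\<Union>j\<in>{N..J}. \<Union>w\<in>Ws j. \<Union>p\<in>Q w. Z p))"
    using cover finWs finQ finZ by (intro of_nat_mono card_mono) auto
  also have "\<dots> \<le> (\<Sum>j\<in>{N..J}. \<Sum>w\<in>Ws j. \<Sum>p\<in>Q w. rho ^ j * ?CC)"
    by (intro order_trans[OF UN_le] sum_mono finWs finQ cardZ) auto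
  also have "\<dots> \<le> (\<Sum>j\<in>{N..J}. 4 ^ card A * (real d ^ 2) ^ l * ?CC * decay ^ j)"
  proof (rule sum_mono)
    fix j
    have "(\<Sum>w\<in>Ws j. \<Sum>p\<in>Q w. rho ^ j * ?CC) \<le> (\<Sum>w\<in>Ws j. (4 ^ card A * 3 ^ j) * (rho ^ j * ?CC))"
    proof (rule sum_mono)
      fix w assume "w \<in> Ws j"
      from cardQ[OF this] have "real (card (Q w)) \<le> real (4 ^ card A * 3 ^ j)" by (simp only: of_nat_le_iff)
      then have "real (card (Q w)) \<le> 4 ^ card A * 3 ^ j" by simp
      then have "real (card (Q w)) * (rho ^ j * ?CC) \<le> (4 ^ card A * 3 ^ j) * (rho ^ j * ?CC)"
        using rho_pos by (intro mult_right_mono) auto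
      then show "(\<Sum>p\<in>Q w. rho ^ j * ?CC) \<le> (4 ^ card A * 3 ^ j) * (rho ^ j * ?CC)" by simp
    qed
    also have "\<dots> = real (card (Ws j)) * ((4 ^ card A * 3 ^ j) * (rho ^ j * ?CC))" by simp
    also have "\<dots> \<le> (real d ^ 2) ^ (l + 2 * j) * ((4 ^ card A * 3 ^ j) * (rho ^ j * ?CC))"
    proof (intro mult_right_mono)
      have "card (Ws j) \<le> card (walks r (l + 2 * j))" unfolding Ws_def using card_walks by (intro card_mono) auto
      also have "\<dots> \<le> (d ^ 2) ^ (l + 2 * j)" using card_walks by blast
      finally have "real (card (Ws j)) \<le> real ((d ^ 2) ^ (l + 2 * j))" by (simp only: of_nat_le_iff)
      then show "real (card (Ws j)) \<le> (real d ^ 2) ^ (l + 2 * j)" by simp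
    qed (use rho_pos in auto)
    also have "(real d ^ 2) ^ (l + 2 * j) = (real d ^ 2) ^ l * (real d ^ 4) ^ j"
      by (simp add: power_add power_mult[symmetric])
    also have "(real d ^ 2) ^ l * (real d ^ 4) ^ j * ((4 ^ card A * 3 ^ j) * (rho ^ j * ?CC))
        = 4 ^ card A * (real d ^ 2) ^ l * ?CC * decay ^ j"
      by (simp add: decay_def power_mult_distrib mult_ac)
    finally show "(\<Sum>w\<in>Ws j. \<Sum>p\<in>Q w. rho ^ j * ?CC) \<le> 4 ^ card A * (real d ^ 2) ^ l * ?CC * decay ^ j" .
  qed
  also have "\<dots> = 4 ^ card A * (real d ^ 2) ^ l * ?CC * (\<Sum>j\<in>{N..J}. decay ^ j)"
    by (rule sum_distrib_left[symmetric])
  also have "\<dots> \<le> 4 ^ card A * (real d ^ 2) ^ l * ?CC * (decay ^ N / (1 - decay))"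
  proof (intro mult_left_mono)
    show "(\<Sum>j\<in>{N..J}. decay ^ j) \<le> decay ^ N / (1 - decay)"
      using decay_pos decay_small by (simp add: sum_gp divide_right_mono)
  qed auto
  finally show ?thesis by (simp add: mult_ac)
qed

end

section \<open>Swapping two configurations on a cluster\<close>

lemma exhaustion_eventually:
  assumes ex: "exhaustion Gn" and R: "finite R"
  shows "\<exists>N. \<forall>n\<ge>N. R \<subseteq> Gn n"
  using R
proof (induction R)
  case (insert x R)
  then obtain N where N: "\<forall>n\<ge>N. R \<subseteq> Gn n" by blast
  obtain k where k: "x \<in> Gn k" using ex unfolding exhaustion_def by blast
  have "Gn k \<subseteq> Gn n" if "k \<le> n" for n
    by (rule lift_Suc_mono_le[OF _ that]) (use ex in \<open>simp add: exhaustion_def\<close>)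
  then have "\<forall>n\<ge>max N k. insert x R \<subseteq> Gn n" using N k by auto
  then show ?case by blast
qed simp

context expander
begin

lemma exhaustion_exists: "\<exists>Gn :: nat \<Rightarrow> 'v set. exhaustion Gn"
proof -
  fix r :: 'v
  have "\<exists>n. v \<in> reach {r} n" if "(r, v) \<in> {(x, y). E x y}\<^sup>*" for v
    using that
  proof induction
    case base
    show ?case by (intro exI[of _ 0]) simp
  next
    case (step y z)
    then obtain n where "y \<in> reach {r} n" by blast
    then have "z \<in> reach {r} (Suc n)" using step.hyps N2_adj[of y z] by auto
    then show ?case by blast
  qed
  then have "(\<Union>n. reach {r} n) = UNIV" using conn unfolding connected_graph_def by blast
  then have "exhaustion (reach {r})" unfolding exhaustion_def by (auto simp: finite_reach)
  then show ?thesis by blast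
qed

text \<open>The extra \<open>Suc\<close> makes room for the boundary of the cluster.\<close>

lemma cluster_closure_subset_reach:
  assumes "w0 \<in> walks r l" "finite X" "card (cluster (set w0) X - set w0) \<le> N"
  shows "cluster (set w0) X \<union> bdry E (cluster (set w0) X) \<subseteq> reach (set w0) (Suc N)"
proof -
  have "cluster (set w0) X \<subseteq> reach (set w0) N"
    using cluster_walk(2)[OF assms(1,2)] reach_mono[OF assms(3)] by blast
  then show ?thesis using N2_adj by (fastforce simp: bdry_def)
qed

end

context ground
begin

text \<open>The region to be exchanged. Adding the boundary moves the interface away from bad
  vertices: wherever a configuration is defined, both ends of an interface edge are good in
  it.\<close>

definition zone :: "'v set \<Rightarrow> 'v set \<Rightarrow> 'v set \<Rightarrow> ('v \<Rightarrow> int) \<Rightarrow> ('v \<Rightarrow> int) \<Rightarrow> 'v set" where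
  "zone U W A f g = (let K = cluster A (bad U f \<union> bad W g) in K \<union> bdry E K)"

lemma zone_commute: "zone U W A f g = zone W U A g f"
  by (simp add: zone_def Un_commute)

text \<open>An edge across the interface joins a good value of \<open>g\<close> to a good value of
  \<open>f\<close>, so it is Lipschitz. Inside the zone \<open>g\<close> is Lipschitz because the
  zone lies in \<open>W\<close>, and the boundary condition of \<open>U\<close> is untouched because
  it lies in \<open>U\<close>.\<close>

lemma cfgs_glue:
  assumes f: "f \<in> C U" and g: "g \<in> C W" and Z: "zone U W A f g \<subseteq> U \<inter> W"
  shows "(\<lambda>x. if x \<in> zone U W A f g then g x else f x) \<in> C U" (is "?h \<in> _")
proof -
  define X where "X = bad U f \<union> bad W g"
  define K where "K = cluster A X"
  have zone: "zone U W A f g = K \<union> bdry E K" by (simp add: zone_def K_def X_def Let_def)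
  have KU: "K \<union> bdry E K \<subseteq> U \<inter> W" using Z zone by simp
  have glue: "\<bar>g u - f v\<bar> \<le> M"
    if uv: "u \<in> K \<union> bdry E K" "v \<notin> K \<union> bdry E K" "E u v" "v \<in> U \<union> bdry E U" for u v
  proof -
    have u: "u \<notin> K" "u \<in> bdry E K" using uv by (auto simp: bdry_def)
    then obtain k where k: "k \<in> K" "E k u" by (auto simp: bdry_def)
    have "u \<in> N2 k" using k N2_adj by blast
    then have "u \<notin> X" using k u(1) cluster.step unfolding K_def by blast
    moreover have "u \<in> W" using u KU by blast
    ultimately have gu: "g u \<in> {lo u..hi u}" using good_if_not_bad[OF g, of u] by (simp add: X_def)
    have "v \<in> N2 k" using k uv by (intro N2_adj2[of k u]) auto
    then have "v \<notin> X" using k uv(2) cluster.step unfolding K_def by blast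
    then have "f v \<in> {lo v..hi v}" using good_if_not_bad[OF f uv(4)] by (simp add: X_def)
    then show ?thesis using good_adj[OF uv(3) gu] by blast
  qed
  show ?thesis unfolding zone
  proof (rule cfgsI)
    fix x assume "x \<notin> U \<union> bdry E U"
    moreover from this have "x \<notin> K \<union> bdry E K" using KU by blast
    ultimately show "(if x \<in> K \<union> bdry E K then g x else f x) = 0" using f unfolding cfgs_iff by simp
  next
    fix v assume v: "v \<in> bdry E U"
    then have "v \<notin> K \<union> bdry E K" using KU unfolding bdry_def by blast
    then show "(if v \<in> K \<union> bdry E K then g v else f v) \<in> {lo v..hi v}"
      using f v unfolding cfgs_iff by simp
  next
    fix u v assume uv: "u \<in> U \<union> bdry E U" "v \<in> U \<union> bdry E U" "E u v"
    consider "u \<in> K \<union> bdry E K" "v \<in> K \<union> bdry E K" | "u \<in> K \<union> bdry E K" "v \<notin> K \<union> bdry E K"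
      | "u \<notin> K \<union> bdry E K" "v \<in> K \<union> bdry E K" | "u \<notin> K \<union> bdry E K" "v \<notin> K \<union> bdry E K" by blast
    then show "\<bar>(if u \<in> K \<union> bdry E K then g u else f u) - (if v \<in> K \<union> bdry E K then g v else f v)\<bar> \<le> M"
    proof cases
      case 1
      then have "u \<in> W" "v \<in> W" using KU by blast+
      then show ?thesis using 1 cfgs_lip[OF g _ _ uv(3)] by simp
    next
      case 2
      then show ?thesis using glue[OF 2 uv(3,2)] by simp
    next
      case 3
      then show ?thesis using glue[OF 3(2,1) E_sym[OF uv(3)] uv(1)] by (simp add: abs_minus_commute)
    next
      case 4
      then show ?thesis using cfgs_lip[OF f uv] by simp
    qed
  qed
qed

definition swap_zone where
  "swap_zone U W A p = (let Z = zone U W A (fst p) (snd p) in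
     ((\<lambda>x. if x \<in> Z then snd p x else fst p x), (\<lambda>x. if x \<in> Z then fst p x else snd p x)))"

text \<open>The exchange is an involution because the zone is computed from data that it
  preserves.\<close>

lemma swap_zone:
  assumes p: "p \<in> C U \<times> C W" and Z: "zone U W A (fst p) (snd p) \<subseteq> U \<inter> W"
  shows "swap_zone U W A p \<in> C U \<times> C W"
    and "zone U W A (fst (swap_zone U W A p)) (snd (swap_zone U W A p)) = zone U W A (fst p) (snd p)"
    and "swap_zone U W A (swap_zone U W A p) = p"
    and "x \<in> A \<Longrightarrow> fst (swap_zone U W A p) x = snd p x"
    and "x \<in> A \<Longrightarrow> snd (swap_zone U W A p) x = fst p x"
proof -
  obtain f g where fg: "p = (f, g)" by fastforce
  define D where "D = zone U W A f g"
  have sw: "swap_zone U W A p = ((\<lambda>x. if x \<in> D then g x else f x), (\<lambda>x. if x \<in> D then f x else g x))"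
    unfolding swap_zone_def D_def fg Let_def fst_conv snd_conv ..
  have DU: "D \<subseteq> U \<inter> W" using Z by (simp add: D_def fg)
  show "swap_zone U W A p \<in> C U \<times> C W"
    using cfgs_glue[of f U g W A] cfgs_glue[of g W f U A] p DU
    unfolding sw by (auto simp: fg D_def zone_commute[of W U])
  \<comment> \<open>Good intervals are the same for both samples and \<open>D\<close> lies in both
    domains, so the exchange only decides which sample is bad at a vertex; the union of the bad sets
    is preserved.\<close>
  have "bad U (\<lambda>x. if x \<in> D then g x else f x) \<union> bad W (\<lambda>x. if x \<in> D then f x else g x) = bad U f \<union> bad W g"
    using DU unfolding bad_def by auto
  then have z: "zone U W A (\<lambda>x. if x \<in> D then g x else f x) (\<lambda>x. if x \<in> D then f x else g x) = D"
    unfolding D_def zone_def by simp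
  then show "zone U W A (fst (swap_zone U W A p)) (snd (swap_zone U W A p)) = zone U W A (fst p) (snd p)"
    unfolding sw by (simp add: fg D_def)
  show "swap_zone U W A (swap_zone U W A p) = p"
    unfolding sw unfolding swap_zone_def by (auto simp: z Let_def fg)
  have "A \<subseteq> D" unfolding D_def zone_def Let_def by (auto intro: cluster.base)
  then show "x \<in> A \<Longrightarrow> fst (swap_zone U W A p) x = snd p x"
    and "x \<in> A \<Longrightarrow> snd (swap_zone U W A p) x = fst p x"
    unfolding sw by (auto simp: fg)
qed

lemma prob_nu: "finite U \<Longrightarrow> measure_pmf.prob (nu E white M a b U) S = real (card (C U \<inter> S)) / real (card (C U))"
  unfolding nu_def by (rule measure_pmf_of_set[OF cfgs_nonempty finite_cfgs])

text \<open>On the good event \<open>G\<close> the exchange matches pairs whose first sample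
  satisfies \<open>S\<close> with pairs whose second does. The two probabilities can differ only
  through pairs outside \<open>G\<close>, whose cluster is large. The bound does not depend on
  \<open>S\<close>, so it controls total variation.\<close>

lemma nu_close:
  assumes U: "finite U" and W: "finite W" and w0: "w0 \<in> walks r l"
    and sub: "reach (set w0) (Suc N) \<subseteq> U \<inter> W"
  shows "\<bar>measure_pmf.prob (nu E white M a b U) {f. restrict f (set w0) \<in> S}
      - measure_pmf.prob (nu E white M a b W) {f. restrict f (set w0) \<in> S}\<bar>
    \<le> 4 ^ card (set w0) * (real d ^ 2) ^ l * (decay ^ N / (1 - decay))"
proof -
  let ?A = "set w0"
  let ?s = "swap_zone U W ?A"
  define \<Omega> where "\<Omega> = C U \<times> C W"
  define G where "G = {p \<in> \<Omega>. zone U W ?A (fst p) (snd p) \<subseteq> U \<inter> W}"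
  define S1 where "S1 = {p \<in> \<Omega>. restrict (fst p) ?A \<in> S}"
  define S2 where "S2 = {p \<in> \<Omega>. restrict (snd p) ?A \<in> S}"
  let ?CC = "real (card (C U)) * real (card (C W))"
  have fin: "finite \<Omega>" unfolding \<Omega>_def using finite_cfgs U W by auto
  have r1: "restrict (fst (?s p)) ?A = restrict (snd p) ?A"
    and r2: "restrict (snd (?s p)) ?A = restrict (fst p) ?A" if "p \<in> G" for p
    using swap_zone(4,5)[of p U W ?A] that unfolding G_def \<Omega>_def by (auto intro!: restrict_ext)
  have sG: "?s p \<in> G" and ss: "?s (?s p) = p" if "p \<in> G" for p
    using swap_zone(1-3)[of p U W ?A] that unfolding G_def \<Omega>_def by auto
  have "bij_betw ?s (S1 \<inter> G) (S2 \<inter> G)"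
  proof (rule bij_betw_byWitness[where f' = ?s])
    show "\<forall>p\<in>S1 \<inter> G. ?s (?s p) = p" "\<forall>p\<in>S2 \<inter> G. ?s (?s p) = p" using ss by auto
    have G\<Omega>: "p \<in> \<Omega>" if "p \<in> G" for p using that by (simp add: G_def)
    have "?s p \<in> S2" if "p \<in> S1 \<inter> G" for p
      using that r2[of p] G\<Omega>[OF sG[of p]] by (simp add: S1_def S2_def)
    then show "?s ` (S1 \<inter> G) \<subseteq> S2 \<inter> G" using sG by blast
    have "?s p \<in> S1" if "p \<in> S2 \<inter> G" for p
      using that r1[of p] G\<Omega>[OF sG[of p]] by (simp add: S1_def S2_def)
    then show "?s ` (S2 \<inter> G) \<subseteq> S1 \<inter> G" using sG by blast
  qed
  then have eq: "card (S1 \<inter> G) = card (S2 \<inter> G)" by (rule bij_betw_same_card)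
  have "\<Omega> - G \<subseteq> large_cluster U W ?A N"
  proof
    fix p assume p: "p \<in> \<Omega> - G"
    obtain f g where fg: "p = (f, g)" by fastforce
    define X where "X = bad U f \<union> bad W g"
    have X: "finite X" unfolding X_def using U W by (auto simp: bad_def)
    have "\<not> cluster ?A X \<union> bdry E (cluster ?A X) \<subseteq> U \<inter> W"
      using p unfolding G_def fg zone_def X_def Let_def by simp
    then have "\<not> card (cluster ?A X - ?A) \<le> N"
      using cluster_closure_subset_reach[OF w0 X] sub by blast
    then show "p \<in> large_cluster U W ?A N" using p unfolding large_cluster_def fg X_def \<Omega>_def by auto
  qed
  moreover have "finite (large_cluster U W ?A N)"
    by (rule finite_subset[OF _ fin]) (auto simp: large_cluster_def \<Omega>_def)
  ultimately have bad: "card (\<Omega> - G) \<le> card (large_cluster U W ?A N)" by (intro card_mono)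
  have split: "card S' \<le> card (S' \<inter> G) + card (\<Omega> - G)" "card (S' \<inter> G) \<le> card S'" if "S' \<subseteq> \<Omega>" for S'
  proof -
    have fS: "finite S'" using that fin finite_subset by blast
    have "card S' \<le> card ((S' \<inter> G) \<union> (\<Omega> - G))" using that fin fS by (intro card_mono) auto
    also have "\<dots> \<le> card (S' \<inter> G) + card (\<Omega> - G)" by (rule card_Un_le)
    finally show "card S' \<le> card (S' \<inter> G) + card (\<Omega> - G)" .
    show "card (S' \<inter> G) \<le> card S'" using fS by (intro card_mono) auto
  qed
  have "S1 \<subseteq> \<Omega>" "S2 \<subseteq> \<Omega>" by (auto simp: S1_def S2_def)
  from split[OF this(1)] split[OF this(2)] bad eq
  have "\<bar>real (card S1) - real (card S2)\<bar> \<le> real (card (large_cluster U W ?A N))" by linarith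
  also have "\<dots> \<le> 4 ^ card ?A * (real d ^ 2) ^ l * (decay ^ N / (1 - decay)) * ?CC"
    using card_large_cluster_le[OF U W w0] .
  finally have main: "\<bar>real (card S1) - real (card S2)\<bar> \<le> 4 ^ card ?A * (real d ^ 2) ^ l * (decay ^ N / (1 - decay)) * ?CC" .
  have pos: "0 < real (card (C U))" "0 < real (card (C W))" using card_cfgs_pos U W by auto
  have "S1 = (C U \<inter> {f. restrict f ?A \<in> S}) \<times> C W" "S2 = C U \<times> (C W \<inter> {f. restrict f ?A \<in> S})"
    by (auto simp: S1_def S2_def \<Omega>_def)
  then have "measure_pmf.prob (nu E white M a b U) {f. restrict f ?A \<in> S} = real (card S1) / ?CC"
    "measure_pmf.prob (nu E white M a b W) {f. restrict f ?A \<in> S} = real (card S2) / ?CC"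
    using pos U W by (simp_all add: prob_nu card_cartesian_product)
  then have "\<bar>measure_pmf.prob (nu E white M a b U) {f. restrict f ?A \<in> S}
      - measure_pmf.prob (nu E white M a b W) {f. restrict f ?A \<in> S}\<bar> = \<bar>real (card S1) - real (card S2)\<bar> / ?CC"
    using pos by (simp add: diff_divide_distrib[symmetric] abs_divide)
  also have "\<dots> \<le> 4 ^ card ?A * (real d ^ 2) ^ l * (decay ^ N / (1 - decay))"
    using main pos by (simp add: pos_divide_le_eq)
  finally show ?thesis .
qed

text \<open>The radius \<open>N\<close> depends on \<open>A\<close> and \<open>e\<close> alone, so
  one set \<open>R\<close> serves all domains. This yields both the Cauchy property along an
  exhaustion and the independence of the exhaustion.\<close>

lemma nu_uniform:
  assumes A: "finite A" and e: "e > 0"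
  shows "\<exists>R. finite R \<and> (\<forall>U W S. finite U \<longrightarrow> finite W \<longrightarrow> R \<subseteq> U \<inter> W \<longrightarrow>
    \<bar>measure_pmf.prob (nu E white M a b U) {f. restrict f A \<in> S}
      - measure_pmf.prob (nu E white M a b W) {f. restrict f A \<in> S}\<bar> \<le> e)"
proof -
  obtain r l w0 where w0: "w0 \<in> walks r l" "A \<subseteq> set w0" using walk_covering[OF A] by blast
  have "(\<lambda>N. 4 ^ card (set w0) * (real d ^ 2) ^ l * (decay ^ N / (1 - decay))) \<longlonglongrightarrow>
      4 ^ card (set w0) * (real d ^ 2) ^ l * (0 / (1 - decay))"
    using decay_pos decay_small by (intro tendsto_intros LIMSEQ_power_zero) auto
  then have "(\<lambda>N. 4 ^ card (set w0) * (real d ^ 2) ^ l * (decay ^ N / (1 - decay))) \<longlonglongrightarrow> 0" by simp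
  from order_tendstoD(2)[OF this e] obtain N where
    N: "4 ^ card (set w0) * (real d ^ 2) ^ l * (decay ^ N / (1 - decay)) < e"
    unfolding eventually_sequentially by blast
  have "\<bar>measure_pmf.prob (nu E white M a b U) {f. restrict f A \<in> S}
      - measure_pmf.prob (nu E white M a b W) {f. restrict f A \<in> S}\<bar> \<le> e"
    if "finite U" "finite W" "reach (set w0) (Suc N) \<subseteq> U \<inter> W" for U W S
  proof -
    have "{f. restrict f A \<in> S} = {f. restrict f (set w0) \<in> {g. restrict g A \<in> S}}"
      using w0(2) by (simp add: Int_absorb1)
    then show ?thesis using nu_close[OF that(1,2) w0(1) that(3), of "{g. restrict g A \<in> S}"] N by simp
  qed
  then show ?thesis using finite_reach[of "set w0" "Suc N"] by blast
qed

section \<open>Convergence along every exhaustion\<close>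

lemma cylinder_restrict: "{f. \<forall>x\<in>A. f x = \<xi> x} = {f. restrict f A \<in> {restrict \<xi> A}}"
  by (auto simp: restrict_def fun_eq_iff)

lemma nu_limit:
  "\<exists>\<mu>. prob_space \<mu> \<and> sets \<mu> = sets config_space \<and>
     (\<forall>Gn. exhaustion Gn \<longrightarrow> local_conv (\<lambda>n. nu E white M a b (Gn n)) \<mu>)"
proof -
  obtain H :: "nat \<Rightarrow> 'v set" where H: "exhaustion H" using exhaustion_exists by blast
  have fin: "finite (Gn n)" if "exhaustion Gn" for Gn :: "nat \<Rightarrow> 'v set" and n
    using that unfolding exhaustion_def by blast
  obtain \<mu> where \<mu>: "prob_space \<mu>" "sets \<mu> = sets config_space"
    "local_conv (\<lambda>n. nu E white M a b (H n)) \<mu>"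
  proof -
    have "\<exists>\<mu>. prob_space \<mu> \<and> sets \<mu> = sets config_space \<and> local_conv (\<lambda>n. nu E white M a b (H n)) \<mu>"
    proof (rule local_limit_exists)
      fix A :: "'v set" and e :: real assume "finite A" "e > 0"
      from nu_uniform[OF this] obtain R where R: "finite R"
        "\<And>U W S. finite U \<Longrightarrow> finite W \<Longrightarrow> R \<subseteq> U \<inter> W \<Longrightarrow>
          \<bar>measure_pmf.prob (nu E white M a b U) {f. restrict f A \<in> S}
            - measure_pmf.prob (nu E white M a b W) {f. restrict f A \<in> S}\<bar> \<le> e" by blast
      obtain N where "\<forall>n\<ge>N. R \<subseteq> H n" using exhaustion_eventually[OF H R(1)] by blast
      then show "\<exists>N. \<forall>m\<ge>N. \<forall>n\<ge>N. \<forall>S.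
          \<bar>measure_pmf.prob (nu E white M a b (H m)) {f. restrict f A \<in> S}
            - measure_pmf.prob (nu E white M a b (H n)) {f. restrict f A \<in> S}\<bar> \<le> e"
        using R(2)[OF fin[OF H] fin[OF H]] by (metis Int_subset_iff)
    qed
    then show thesis using that by blast
  qed
  have "local_conv (\<lambda>n. nu E white M a b (Gn n)) \<mu>" if G: "exhaustion Gn" for Gn
    unfolding local_conv_def
  proof (intro allI impI)
    fix A :: "'v set" and \<xi> :: "'v \<Rightarrow> int" assume A: "finite A"
    define p where "p U = measure_pmf.prob (nu E white M a b U) {f. \<forall>x\<in>A. f x = \<xi> x}" for U
    \<comment> \<open>Any exhaustion is compared with the reference exhaustion \<open>H\<close>
      along which \<open>\<mu>\<close> was constructed.\<close>
    have "(\<lambda>n. p (Gn n) - p (H n)) \<longlonglongrightarrow> 0"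
    proof (rule LIMSEQ_I)
      fix e :: real assume "0 < e"
      then have "0 < e / 2" by simp
      from nu_uniform[OF A this] obtain R where R: "finite R"
        "\<And>U W S. finite U \<Longrightarrow> finite W \<Longrightarrow> R \<subseteq> U \<inter> W \<Longrightarrow>
          \<bar>measure_pmf.prob (nu E white M a b U) {f. restrict f A \<in> S}
            - measure_pmf.prob (nu E white M a b W) {f. restrict f A \<in> S}\<bar> \<le> e / 2" by blast
      obtain N1 N2 where N: "\<forall>n\<ge>N1. R \<subseteq> H n" "\<forall>n\<ge>N2. R \<subseteq> Gn n"
        using exhaustion_eventually[OF H R(1)] exhaustion_eventually[OF G R(1)] by blast
      have "norm (p (Gn n) - p (H n) - 0) < e" if "max N1 N2 \<le> n" for n
      proof -
        have "R \<subseteq> Gn n \<inter> H n" using N that by simp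
        from R(2)[OF fin[OF G] fin[OF H] this, of "{restrict \<xi> A}"]
        show ?thesis using \<open>0 < e\<close> unfolding p_def cylinder_restrict by simp
      qed
      then show "\<exists>no. \<forall>n\<ge>no. norm (p (Gn n) - p (H n) - 0) < e" by blast
    qed
    moreover have "(\<lambda>n. p (H n)) \<longlonglongrightarrow> cyl \<mu> A \<xi>" using \<mu>(3) A unfolding local_conv_def p_def by blast
    ultimately have "(\<lambda>n. (p (Gn n) - p (H n)) + p (H n)) \<longlonglongrightarrow> 0 + cyl \<mu> A \<xi>" by (rule tendsto_add)
    then show "(\<lambda>n. measure_pmf.prob (nu E white M a b (Gn n)) {f. \<forall>x\<in>A. f x = \<xi> x}) \<longlonglongrightarrow> cyl \<mu> A \<xi>"
      by (simp add: p_def)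
  qed
  then show ?thesis using \<mu> by blast
qed

section \<open>The DLR equations in finite volume and in the limit\<close>

lemma cfgs_override:
  assumes f: "f \<in> C V" and UL: "U \<union> bdry E U \<subseteq> \<Lambda>" and V: "U \<subseteq> V"
    and eq: "\<And>x. x \<in> \<Lambda> - U \<Longrightarrow> f x = \<xi> x"
    and g: "lip_touch E M U (\<lambda>x. if x \<in> U then g x else \<xi> x)"
  shows "(\<lambda>x. if x \<in> U then g x else f x) \<in> C V"
proof -
  have touch: "\<bar>g u - (if v \<in> U then g v else f v)\<bar> \<le> M" if "u \<in> U" "E u v" for u v
  proof -
    have "v \<in> \<Lambda>" using adj_in_closure[OF that] UL by blast
    then show ?thesis using g[unfolded lip_touch_def, rule_format, OF that] that eq[of v]
      by (cases "v \<in> U") simp_all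
  qed
  show ?thesis
  proof (rule cfgsI)
    fix x assume "x \<notin> V \<union> bdry E V"
    moreover from this have "x \<notin> U" using V by blast
    ultimately show "(if x \<in> U then g x else f x) = 0" using f unfolding cfgs_iff by simp
  next
    fix v assume v: "v \<in> bdry E V"
    then have "v \<notin> U" using V unfolding bdry_def by blast
    then show "(if v \<in> U then g v else f v) \<in> {lo v..hi v}" using f v unfolding cfgs_iff by simp
  next
    fix u v assume uv: "u \<in> V \<union> bdry E V" "v \<in> V \<union> bdry E V" "E u v"
    consider "u \<in> U" | "v \<in> U" "u \<notin> U" | "u \<notin> U" "v \<notin> U" by blast
    then show "\<bar>(if u \<in> U then g u else f u) - (if v \<in> U then g v else f v)\<bar> \<le> M"
    proof cases
      case 1
      then show ?thesis using touch[OF 1 uv(3)] by simp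
    next
      case 2
      then show ?thesis using touch[OF 2(1) E_sym[OF uv(3)]] by (simp add: abs_minus_commute)
    next
      case 3
      then show ?thesis using cfgs_lip[OF f uv] by simp
    qed
  qed
qed

text \<open>A configuration that agrees with \<open>\<xi>\<close> on \<open>\<Lambda> - U\<close>
  splits into its part inside \<open>U\<close>, an arbitrary Lipschitz extension, and its part
  outside. When \<open>\<xi>\<close> itself is admissible on \<open>U\<close>, filling the hole with
  \<open>\<xi>\<close> identifies the outside parts with \<open>F\<close>, so \<open>F'\<close>
  corresponds to \<open>F \<times> ?X\<close>.\<close>

lemma nu_gibbs:
  assumes V: "finite V" "U \<subseteq> V" and UL: "U \<union> bdry E U \<subseteq> \<Lambda>"
  shows "measure_pmf.prob (nu E white M a b V) {f. \<forall>x\<in>\<Lambda>. f x = \<xi> x} =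
    measure_pmf.prob (nu E white M a b V) {f. \<forall>x\<in>\<Lambda> - U. f x = \<xi> x} *
      (if lip_touch E M U \<xi> then 1 / real (card (extensions E M U \<xi>)) else 0)"
proof -
  define F where "F = C V \<inter> {f. \<forall>x\<in>\<Lambda>. f x = \<xi> x}"
  define F' where "F' = C V \<inter> {f. \<forall>x\<in>\<Lambda> - U. f x = \<xi> x}"
  let ?X = "extensions E M U \<xi>"
  have fin: "finite F" "finite F'" using finite_cfgs[OF V(1)] by (auto simp: F_def F'_def)
  have touch: "lip_touch E M U (\<lambda>x. if x \<in> U then f x else \<xi> x)" if f: "f \<in> F'" for f
    unfolding lip_touch_def
  proof (intro ballI allI impI)
    fix u v assume uv: "u \<in> U" "E u v"
    have "v \<in> \<Lambda>" using adj_in_closure[OF uv] UL by blast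
    then have "v \<notin> U \<Longrightarrow> f v = \<xi> v" using f by (simp add: F'_def)
    moreover have "u \<in> V" using uv V by blast
    moreover from this have "v \<in> V \<union> bdry E V" using uv(2) by (rule adj_in_closure)
    ultimately show "\<bar>(if u \<in> U then f u else \<xi> u) - (if v \<in> U then f v else \<xi> v)\<bar> \<le> M"
      using cfgs_lip[of f V u v] f uv by (auto simp: F'_def)
  qed
  have "real (card F) = real (card F') * (if lip_touch E M U \<xi> then 1 / real (card ?X) else 0)"
  proof (cases "lip_touch E M U \<xi>")
    case False
    have "F = {}"
    proof (rule ccontr)
      assume "F \<noteq> {}"
      then obtain f where f: "f \<in> F" by blast
      then have "f \<in> F'" by (simp add: F_def F'_def)
      moreover have "(\<lambda>x. if x \<in> U then f x else \<xi> x) = \<xi>" using f UL by (intro ext) (auto simp: F_def)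
      ultimately show False using touch[of f] False by simp
    qed
    then show ?thesis using False by simp
  next
    case True
    have "bij_betw (\<lambda>f. ((\<lambda>x. if x \<in> U then \<xi> x else f x), (\<lambda>x. if x \<in> U then f x else 0))) F' (F \<times> ?X)"
    proof (rule bij_betw_byWitness[where f' = "\<lambda>(f, g) x. if x \<in> U then g x else f x"])
      show "(\<lambda>f. ((\<lambda>x. if x \<in> U then \<xi> x else f x), (\<lambda>x. if x \<in> U then f x else 0))) ` F' \<subseteq> F \<times> ?X"
      proof clarify
        fix f assume f: "f \<in> F'"
        have "(\<lambda>x. if x \<in> U then \<xi> x else f x) \<in> C V"
          using f True by (intro cfgs_override[of f V U \<Lambda> \<xi>] UL V) (auto simp: F'_def)
        then have "(\<lambda>x. if x \<in> U then \<xi> x else f x) \<in> F" using f by (auto simp: F_def F'_def)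
        moreover have "(\<lambda>x. if x \<in> U then if x \<in> U then f x else 0 else \<xi> x) = (\<lambda>x. if x \<in> U then f x else \<xi> x)"
          by auto
        then have "(\<lambda>x. if x \<in> U then f x else 0) \<in> ?X"
          using touch[OF f] unfolding extensions_def by simp
        ultimately show "(\<lambda>x. if x \<in> U then \<xi> x else f x) \<in> F \<and> (\<lambda>x. if x \<in> U then f x else 0) \<in> ?X" by blast
      qed
      show "(\<lambda>(f, g) x. if x \<in> U then g x else f x) ` (F \<times> ?X) \<subseteq> F'"
      proof clarify
        fix f g assume f: "f \<in> F" and g: "g \<in> ?X"
        have "(\<lambda>x. if x \<in> U then g x else f x) \<in> C V"
          using f g by (intro cfgs_override[of f V U \<Lambda> \<xi>] UL V) (auto simp: F_def extensions_def)
        then show "(\<lambda>x. if x \<in> U then g x else f x) \<in> F'" using f by (auto simp: F_def F'_def)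
      qed
      show "\<forall>p\<in>F \<times> ?X. (\<lambda>f. ((\<lambda>x. if x \<in> U then \<xi> x else f x), (\<lambda>x. if x \<in> U then f x else 0)))
          ((\<lambda>(f, g) x. if x \<in> U then g x else f x) p) = p"
        using UL by (auto simp: F_def extensions_def fun_eq_iff)
    qed auto
    from bij_betw_same_card[OF this] have card: "card F' = card F * card ?X"
      by (simp only: card_cartesian_product)
    show ?thesis
    \<comment> \<open>Cardinality \<open>0\<close> covers both the empty and the infinite case.
      Either way \<open>F'\<close> is empty, and the convention for division by zero is
      harmless.\<close>
    proof (cases "card ?X = 0")
      case True
      then have "F' = {}" using card fin by simp
      then have "F = {}" by (auto simp: F_def F'_def)
      then show ?thesis using True by simp
    next
      case False
      then show ?thesis using card True by simp
    qed
  qed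
  then show ?thesis using V(1) by (simp add: prob_nu F_def F'_def)
qed

text \<open>For fixed \<open>U\<close> and \<open>\<Lambda>\<close> the identity holds exactly as
  soon as \<open>Gn n\<close> contains \<open>U\<close>, and it involves only two cylinder
  probabilities, so it passes to the limit.\<close>

lemma gibbs_limit:
  assumes \<mu>: "prob_space \<mu>" "sets \<mu> = sets config_space"
    and ex: "exhaustion Gn" and conv: "local_conv (\<lambda>n. nu E white M a b (Gn n)) \<mu>"
  shows "gibbs E M \<mu>"
  unfolding gibbs_def
proof (intro conjI \<mu> allI impI)
  fix U \<Lambda> :: "'v set" and \<xi> :: "'v \<Rightarrow> int"
  assume "finite U \<and> finite \<Lambda> \<and> U \<union> bdry E U \<subseteq> \<Lambda>"
  then have U: "finite U" and L: "finite \<Lambda>" and UL: "U \<union> bdry E U \<subseteq> \<Lambda>" by auto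
  let ?c = "if lip_touch E M U \<xi> then 1 / real (card (extensions E M U \<xi>)) else 0"
  let ?p = "\<lambda>A n. measure_pmf.prob (nu E white M a b (Gn n)) {f. \<forall>x\<in>A. f x = \<xi> x}"
  obtain N where N: "\<forall>n\<ge>N. U \<subseteq> Gn n" using exhaustion_eventually[OF ex U] by blast
  have eq: "?p \<Lambda> n = ?p (\<Lambda> - U) n * ?c" if "n \<ge> N" for n
    using that N ex by (intro nu_gibbs UL) (auto simp: exhaustion_def)
  have ev: "eventually (\<lambda>n. ?p (\<Lambda> - U) n * ?c = ?p \<Lambda> n) sequentially"
    unfolding eventually_sequentially by (intro exI[of _ N] allI impI eq[symmetric])
  have "(\<lambda>n. ?p (\<Lambda> - U) n * ?c) \<longlonglongrightarrow> cyl \<mu> (\<Lambda> - U) \<xi> * ?c"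
    using conv L unfolding local_conv_def by (intro tendsto_mult_right) auto
  then have "?p \<Lambda> \<longlonglongrightarrow> cyl \<mu> (\<Lambda> - U) \<xi> * ?c" using ev by (rule Lim_transform_eventually)
  moreover have "?p \<Lambda> \<longlonglongrightarrow> cyl \<mu> \<Lambda> \<xi>" using conv L unfolding local_conv_def by blast
  ultimately show "cyl \<mu> \<Lambda> \<xi> = cyl \<mu> (\<Lambda> - U) \<xi> * ?c" by (rule LIMSEQ_unique[rotated])
qed

section \<open>Bounds for one-vertex marginals\<close>

lemma card_bad_near_le:
  assumes U: "finite U"
  shows "real (card {f \<in> C U. \<exists>y\<in>N2 u. y \<noteq> u \<and> y \<in> bad U f}) \<le> 4 * (decay / (1 - decay)) * real (card (C U))"
    (is "real (card ?B) \<le> _")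
proof -
  have w: "[u] \<in> walks u 0" by (simp add: walks_def)
  \<comment> \<open>The second sample is arbitrary, so its factor \<open>card (C U)\<close> cancels
    at the end. With the one-point walk \<open>[u]\<close> as seed the prefactor is
    \<open>4 ^ 1\<close>. The seed does not count as a new vertex, so the estimate concerns only
    vertices around \<open>u\<close>.\<close>
  have "?B \<times> C U \<subseteq> large_cluster U U (set [u]) 1"
  proof clarify
    fix f g y assume f: "f \<in> C U" and g: "g \<in> C U" and y: "y \<in> N2 u" "y \<noteq> u" "y \<in> bad U f"
    let ?K = "cluster (set [u]) (bad U f \<union> bad U g)"
    have "u \<in> ?K" by (intro cluster.base) simp
    then have "y \<in> ?K - set [u]" using y cluster.step[of u "set [u]" "bad U f \<union> bad U g" y] by auto
    moreover have "finite ?K"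
      by (rule finite_subset[OF cluster_subset]) (use U in \<open>auto simp: bad_def\<close>)
    ultimately have "1 \<le> card (?K - set [u])" by (metis One_nat_def Suc_leI card_gt_0_iff empty_iff finite_Diff)
    then show "(f, g) \<in> large_cluster U U (set [u]) 1" using f g by (simp add: large_cluster_def)
  qed
  moreover have "finite (large_cluster U U (set [u]) 1)"
    by (rule finite_subset[of _ "C U \<times> C U"]) (use finite_cfgs[OF U] in \<open>auto simp: large_cluster_def\<close>)
  ultimately have "card (?B \<times> C U) \<le> card (large_cluster U U (set [u]) 1)" by (intro card_mono)
  then have "real (card ?B) * real (card (C U)) \<le> real (card (large_cluster U U (set [u]) 1))"
    by (simp only: card_cartesian_product of_nat_mult[symmetric] of_nat_le_iff)
  also have "\<dots> \<le> (4 * (decay / (1 - decay)) * real (card (C U))) * real (card (C U))"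
    using card_large_cluster_le[OF U U w, of 1] by (simp add: mult.assoc)
  finally show ?thesis by (rule mult_right_le_imp_le) (use card_cfgs_pos[OF U] in simp)
qed

text \<open>Badness of \<open>v\<close> is detected from its neighbour \<open>u\<close>, since a
  seed carries no weight of its own.\<close>

lemma prob_atypical_le:
  assumes U: "finite U" "v \<in> U" and uv: "E u v" and x: "x \<notin> {lo v..hi v}"
  shows "measure_pmf.prob (nu E white M a b U) {f. f v = x} \<le> 4 * (decay / (1 - decay))"
proof -
  have "v \<in> N2 u" "v \<noteq> u" using N2_adj[OF uv] uv E_irrefl by auto
  then have "C U \<inter> {f. f v = x} \<subseteq> {f \<in> C U. \<exists>y\<in>N2 u. y \<noteq> u \<and> y \<in> bad U f}"
    using U x by (auto simp: bad_def)
  then have "card (C U \<inter> {f. f v = x}) \<le> card {f \<in> C U. \<exists>y\<in>N2 u. y \<noteq> u \<and> y \<in> bad U f}"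
    using finite_cfgs[OF U(1)] by (intro card_mono) auto
  then have "real (card (C U \<inter> {f. f v = x})) \<le> 4 * (decay / (1 - decay)) * real (card (C U))"
    using card_bad_near_le[OF U(1), of u] by linarith
  then show ?thesis using card_cfgs_pos[OF U(1)] by (simp add: prob_nu U pos_divide_le_eq)
qed

text \<open>If \<open>v\<close> and all its neighbours are good, the value at \<open>v\<close> may
  be reset to any good \<open>x\<close>. Only the old good value, one of at most
  \<open>2 * M + 1\<close>, is forgotten.\<close>

lemma prob_typical_ge:
  assumes U: "finite U" "insert v (nbrs E v) \<subseteq> U" and uv: "E u v" and x: "x \<in> {lo v..hi v}"
  shows "1 - 8 * (decay / (1 - decay)) \<le> (2 * real_of_int M + 1) * measure_pmf.prob (nu E white M a b U) {f. f v = x}"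
proof -
  let ?B = "\<lambda>u. {f \<in> C U. \<exists>y\<in>N2 u. y \<noteq> u \<and> y \<in> bad U f}"
  define F where "F = C U \<inter> {f. f v = x}"
  define G where "G = {f \<in> C U. v \<notin> bad U f \<and> nbrs E v \<inter> bad U f = {}}"
  have finC: "finite (C U)" by (rule finite_cfgs[OF U(1)])
  have vu: "v \<in> N2 u" "v \<noteq> u" using N2_adj[OF uv] uv E_irrefl by auto
  have nv: "y \<in> N2 v" "y \<noteq> v" if "y \<in> nbrs E v" for y
    using that N2_adj E_irrefl unfolding nbrs_def by auto
  \<comment> \<open>Two estimates with constant \<open>4\<close> give the \<open>8\<close>:
    \<open>?B u\<close> catches badness at \<open>v\<close>, and \<open>?B v\<close> catches badness
    at the neighbours of \<open>v\<close>.\<close>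
  have "C U \<subseteq> G \<union> (?B u \<union> ?B v)" using vu nv by (auto simp: G_def)
  then have "card (C U) \<le> card (G \<union> (?B u \<union> ?B v))" using finC by (intro card_mono) (auto simp: G_def)
  also have "\<dots> \<le> card G + (card (?B u) + card (?B v))"
    by (intro order_trans[OF card_Un_le] add_left_mono card_Un_le)
  finally have 1: "real (card (C U)) \<le> real (card G) + 8 * (decay / (1 - decay)) * real (card (C U))"
    using card_bad_near_le[OF U(1), of u] card_bad_near_le[OF U(1), of v] by linarith
  have "inj_on (\<lambda>f. (f(v := x), f v)) G"
  proof (rule inj_onI)
    fix f g assume "(f(v := x), f v) = (g(v := x), g v)"
    then show "f = g" by (metis Pair_inject fun_upd_triv fun_upd_upd)
  qed
  moreover have "(\<lambda>f. (f(v := x), f v)) ` G \<subseteq> F \<times> {lo v..hi v}"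
  proof clarify
    fix f assume f: "f \<in> G"
    then have fC: "f \<in> C U" by (simp add: G_def)
    have vU: "v \<in> U" "v \<notin> bdry E U" using U by (auto simp: bdry_def)
    have good: "f z \<in> {lo z..hi z}" if "E v z" for z
      using that f U by (intro good_if_not_bad[OF fC]) (auto simp: G_def nbrs_def)
    have xz: "\<bar>x - f z\<bar> \<le> M" if "E v z" for z using good_adj[OF that x good[OF that]] .
    have "f(v := x) \<in> C U"
    proof (rule cfgsI)
      fix y assume "y \<notin> U \<union> bdry E U"
      moreover from this have "y \<noteq> v" using vU by blast
      ultimately show "(f(v := x)) y = 0" using fC unfolding cfgs_iff by simp
    next
      fix y assume y: "y \<in> bdry E U"
      moreover from this have "y \<noteq> v" using vU by blast
      ultimately show "(f(v := x)) y \<in> {lo y..hi y}" using fC unfolding cfgs_iff by simp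
    next
      fix y z assume yz: "y \<in> U \<union> bdry E U" "z \<in> U \<union> bdry E U" "E y z"
      then show "\<bar>(f(v := x)) y - (f(v := x)) z\<bar> \<le> M"
        using cfgs_lip[OF fC yz] xz[of z] xz[of y] E_sym[OF yz(3)] M1 by (auto simp: abs_minus_commute)
    qed
    moreover have "f v \<in> {lo v..hi v}" using f vU by (intro good_if_not_bad[OF fC]) (auto simp: G_def)
    ultimately show "(f(v := x)) \<in> F \<and> f v \<in> {lo v..hi v}" by (simp add: F_def)
  qed
  moreover have "finite (F \<times> {lo v..hi v})" using finC by (auto simp: F_def)
  ultimately have "card G \<le> card (F \<times> {lo v..hi v})" by (rule card_inj_on_le)
  then have "real (card G) \<le> real (card F * card {lo v..hi v})"
    by (simp only: card_cartesian_product of_nat_le_iff)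
  also have "\<dots> = real (card {lo v..hi v}) * real (card F)" by simp
  also have "\<dots> \<le> (2 * real_of_int M + 1) * real (card F)"
    using lo_hi[of v] by (intro mult_right_mono) auto
  finally have "(1 - 8 * (decay / (1 - decay))) * real (card (C U)) \<le> (2 * real_of_int M + 1) * real (card F)"
    using 1 by (simp only: left_diff_distrib)
  then show ?thesis using card_cfgs_pos[OF U(1)]
    by (simp add: prob_nu[OF U(1)] F_def pos_le_divide_eq)
qed

end

section \<open>Distinctness of the limits\<close>

context expander
begin

lemma white_edge_exists: "\<exists>u v. E u v \<and> white v"
proof -
  fix r :: 'v
  have "bdry E {r} \<noteq> {}" by (rule bdry_nonempty) auto
  then obtain s where s: "E r s" by (auto simp: bdry_def)
  then show ?thesis using E_white[OF s] E_sym[OF s] by blast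
qed

text \<open>At a white vertex the value \<open>x\<close> is good for one measure and bad for the
  other. A common limit would give it a probability both bounded below by roughly
  \<open>1 / (2 * M + 1)\<close> and bounded above by a small multiple of
  \<open>decay\<close>.\<close>

lemma limits_distinct:
  assumes 1: "a \<le> b" "b - a \<le> 2 * M" and 2: "a' \<le> b'" "b' - a' \<le> 2 * M"
    and x: "x \<in> {a..b}" "x \<notin> {a'..b'}" and ex: "exhaustion Gn"
    and conv: "local_conv (\<lambda>n. nu E white M a b (Gn n)) \<mu>"
      "local_conv (\<lambda>n. nu E white M a' b' (Gn n)) \<mu>'"
  shows "\<mu> \<noteq> \<mu>'"
proof
  assume eq: "\<mu> = \<mu>'"
  interpret g1: ground E white d M a b by standard (fact 1)+
  interpret g2: ground E white d M a' b' by standard (fact 2)+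
  obtain u v where uv: "E u v" "white v" using white_edge_exists by blast
  obtain N where N: "\<forall>n\<ge>N. insert v (nbrs E v) \<subseteq> Gn n"
    using exhaustion_eventually[OF ex, of "insert v (nbrs E v)"] finite_nbrs by auto
  have fin: "finite (Gn n)" for n using ex unfolding exhaustion_def by blast
  let ?c = "cyl \<mu> {v} (\<lambda>_. x)"
  have "(\<lambda>n. measure_pmf.prob (nu E white M a b (Gn n)) {f. \<forall>y\<in>{v}. f y = x}) \<longlonglongrightarrow> ?c"
    by (rule conv(1)[unfolded local_conv_def, rule_format]) simp
  then have l1: "(\<lambda>n. (2 * real_of_int M + 1) * measure_pmf.prob (nu E white M a b (Gn n)) {f. f v = x}) \<longlonglongrightarrow>
      (2 * real_of_int M + 1) * ?c" by (intro tendsto_mult_left) simp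
  have "1 - 8 * (decay / (1 - decay)) \<le> (2 * real_of_int M + 1) * ?c"
    by (rule LIMSEQ_le_const[OF l1], rule exI[of _ N], intro allI impI, rule g1.prob_typical_ge[OF fin _ uv(1)])
      (use N x uv in \<open>auto simp: g1.lo_def g1.hi_def\<close>)
  moreover have "(\<lambda>n. measure_pmf.prob (nu E white M a' b' (Gn n)) {f. \<forall>y\<in>{v}. f y = x}) \<longlonglongrightarrow> ?c"
    unfolding eq by (rule conv(2)[unfolded local_conv_def, rule_format]) simp
  then have l2: "(\<lambda>n. measure_pmf.prob (nu E white M a' b' (Gn n)) {f. f v = x}) \<longlonglongrightarrow> ?c" by simp
  have "?c \<le> 4 * (decay / (1 - decay))"
    by (rule LIMSEQ_le_const2[OF l2], rule exI[of _ N], intro allI impI, rule g2.prob_atypical_le[OF fin _ uv(1)])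
      (use N x uv in \<open>auto simp: g2.lo_def g2.hi_def\<close>)
  then have "(2 * real_of_int M + 1) * ?c \<le> (2 * real_of_int M + 1) * (4 * (decay / (1 - decay)))"
    using M1 by (intro mult_left_mono) auto
  \<comment> \<open>Combining the two bounds leads to \<open>1 \<le> (8 * M + 13) * decay\<close>,
    which contradicts \<open>decay \<le> 1 / (100 * (M + 1))\<close>.\<close>
  moreover have "1 \<le> 4 * (2 * m + 3) * t" if "1 - 8 * t \<le> y" "y \<le> (2 * m + 1) * (4 * t)" for t y m :: real
    using that by (simp add: algebra_simps)
  ultimately have "1 \<le> 4 * (2 * real_of_int M + 3) * (decay / (1 - decay))" by blast
  then have "1 - decay \<le> 4 * (2 * real_of_int M + 3) * decay" using decay_small by (simp add: pos_le_divide_eq)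
  moreover have "decay * (100 * (real_of_int M + 1)) \<le> 1"
    using decay_le M1 by (simp add: pos_le_divide_eq)
  moreover have "decay * real_of_int M > 0" using decay_pos M1 by simp
  ultimately show False using decay_pos by (simp add: algebra_simps)
qed

end

theorem theorem1p3:
  fixes E :: "'v \<Rightarrow> 'v \<Rightarrow> bool" and white :: "'v \<Rightarrow> bool" and d :: nat and M :: int
  assumes "simple_graph E" and "infinite (UNIV :: 'v set)" and "connected_graph E"
    and "proper_bicolouring E white" and "max_degree E d"
    and "M \<ge> 1"
    and "cheeger E \<ge> 4 * real_of_int M * ln (3 * real d ^ 4 * (4 * real_of_int M + 1))"
  shows "\<exists>\<nu> :: int \<Rightarrow> int \<Rightarrow> ('v \<Rightarrow> int) measure.
     (\<forall>a b. a \<le> b \<and> b - a \<le> 2 * M \<longrightarrow>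
        gibbs E M (\<nu> a b) \<and>
        (\<forall>Gn. exhaustion Gn \<longrightarrow> local_conv (\<lambda>n. nu E white M a b (Gn n)) (\<nu> a b)))
   \<and> (\<forall>a b a' b'. a \<le> b \<and> b - a \<le> 2 * M \<and> a' \<le> b' \<and> b' - a' \<le> 2 * M \<and> (a, b) \<noteq> (a', b')
        \<longrightarrow> \<nu> a b \<noteq> \<nu> a' b')"
proof -
  interpret expander E white d M by standard (fact assms)+
  obtain H :: "nat \<Rightarrow> 'v set" where H: "exhaustion H" using exhaustion_exists by blast
  have "\<exists>\<mu>. gibbs E M \<mu> \<and> (\<forall>Gn. exhaustion Gn \<longrightarrow> local_conv (\<lambda>n. nu E white M a b (Gn n)) \<mu>)"
    if ab: "a \<le> b" "b - a \<le> 2 * M" for a b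
  proof -
    interpret ground E white d M a b by standard (fact ab)+
    show ?thesis using nu_limit gibbs_limit H by metis
  qed
  then obtain \<nu> where \<nu>: "\<And>a b. a \<le> b \<Longrightarrow> b - a \<le> 2 * M \<Longrightarrow>
      gibbs E M (\<nu> a b) \<and> (\<forall>Gn. exhaustion Gn \<longrightarrow> local_conv (\<lambda>n. nu E white M a b (Gn n)) (\<nu> a b))"
    by metis
  have "\<nu> a b \<noteq> \<nu> a' b'" if 1: "a \<le> b" "b - a \<le> 2 * M" and 2: "a' \<le> b'" "b' - a' \<le> 2 * M"
    and ne: "(a, b) \<noteq> (a', b')" for a b a' b'
  proof -
    have conv: "local_conv (\<lambda>n. nu E white M a b (H n)) (\<nu> a b)"
      "local_conv (\<lambda>n. nu E white M a' b' (H n)) (\<nu> a' b')" using \<nu> 1 2 H by blast+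
    \<comment> \<open>Both intervals are nonempty, so distinct pairs give distinct intervals. The
      separating value may lie in either of them, and the two cases are symmetric.\<close>
    have "{a..b} \<noteq> {a'..b'}" using 1 2 ne by (simp add: Icc_eq_Icc)
    then consider x where "x \<in> {a..b}" "x \<notin> {a'..b'}" | x where "x \<in> {a'..b'}" "x \<notin> {a..b}" by blast
    then show ?thesis
    proof cases
      case 1
      then show ?thesis using limits_distinct[OF that(1-4) _ _ H conv] by blast
    next
      case 2
      then show ?thesis using limits_distinct[OF that(3,4,1,2) _ _ H conv(2,1)] by metis
    qed
  qed
  then show ?thesis using \<nu> by (intro exI[of _ \<nu>]) blast
qed

end
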